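(* Let $H$ be the 112-vertex graph constructed in the context from three copies of the four-pole $Q$, a center $c$, and three leaves $\ell_0,\ell_1,\ell_2$, and let $G$ be the explicit 112-vertex graph whose edge list is given in the context. Then $H$ is a simple connected bridgeless cubic graph on 112 vertices and 168 edges, with girth five; its edge-connectivity and vertex-connectivity are both three. It has no Petersen coloring and no normal 5-edge-coloring. Its full automorphism group is $D_3$ (the dihedral group) of order six, and $H$ is not isomorphic to $G$. The SHA-256 digest of the normalized sorted edge list of $H$ is 0f2d8858110c6f012de7ddffa92fdbc709d7da630f199b0e3c81bb56eb6b35c7 (hexadecimal).
   Context: **Colorings.** For cubic graphs $G$ and $H$, an $H$-coloring of $G$ is a map $\varphi:E(G)\to E(H)$ such that at every vertex of $G$ the three incident edges are mapped bijectively onto the three edges incident with some vertex of $H$. A Petersen coloring is an $H$-coloring with $H$ the Petersen graph, realized as the Kneser graph $KG(5,2)$: its vertices are the 2-element subsets of $\{0,1,2,3,4\}$, two being adjacent when disjoint. A proper 5-edge-coloring of a cubic graph is normal if for every edge $uv$, the set of colors appearing on the edges incident with $u$ or with $v$ (including $uv$ itself) has exactly three elements or exactly five elements. **Normalized sorted edge list.** For a graph with integer vertex labels, this is the ASCII JSON array in which every edge is written as $[u,v]$ with $u<v$, the pairs are sorted lexicographically (as integer pairs), the separators are a comma and a colon (so items are separated by "," alone), and no optional whitespace is used. The digest is the SHA-256 hash of this byte string. **The graph $H$.** A multipole is a graph with dangling half-edges (semiedges), each incident with a vertex; if $M$ is a copy of a multipole, $M.j$ is its semiedge with index $j$. Joining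 two semiedges (written $\sim$) produces an edge between their incident vertices; joining a semiedge to a vertex $\ell$ produces an edge from its incident vertex to $\ell$; joining two vertices means adding an edge between them. Let $Q$ be the four-pole on vertices $0,\ldots,35$ whose semiedges $0,1,2,3$ are incident respectively with vertices $2,32,24,16$ and whose internal edge set is $E(Q)=\{\{0,1\},\{0,5\},\{1,2\},\{1,6\},\{2,7\},\{3,5\},\{3,6\},\{4,6\},\{4,7\},\{5,7\},\{8,9\},\{8,10\},\{8,11\},\{9,14\},\{10,12\},\{11,28\},\{12,13\},\{12,17\},\{13,14\},\{13,18\},\{14,19\},\{15,17\},\{15,18\},\{15,22\},\{16,18\},\{16,19\},\{17,19\},\{20,21\},\{20,25\},\{21,22\},\{21,26\},\{22,27\},\{23,25\},\{23,26\},\{23,30\},\{24,26\},\{24,27\},\{25,27\},\{28,29\},\{28,33\},\{29,30\},\{29,34\},\{30,35\},\{31,33\},\{31,34\},\{32,34\},\{32,35\},\{33,35\},\{0,31\},\{3,11\},\{4,9\},\{10,20\}\}$. Take copies $Q_0,Q_1,Q_2$ of $Q$ (indices modulo three), a center vertex $c$, and leaf vertices $\ell_0,\ell_1,\ell_2$. For every $i\in\{0,1,2\}$, join $$Q_i.0\sim Q_{i+1}.3,\qquad Q_i.2\sim \ell_i\sim Q_{i+1}.1,\qquad c\sim \ell_i$$ (twelve joins in total). Labels: vertex $v$ of $Q_i$ is labeled $36i+v$, $c=108$, and $\ell_i=109+i$. The resulting labeled graph is $H$. **The graph $G$.** $G$ has vertex set $\{0,\ldots,111\}$ and the following 168 edges.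 The notation "$u: v_1,v_2,\ldots$" lists all edges $\{u,v_i\}$ with $u<v_i$; vertices not shown before a colon have no larger neighbor. 0: 1,5,31; 1: 2,6; 2: 7,100; 3: 5,6,11; 4: 6,7,9; 5: 7; 8: 9,10,11; 9: 14; 10: 12,20; 11: 28; 12: 13,17; 13: 14,18; 14: 19; 15: 17,18,22; 16: 18,19,56; 17: 19; 20: 21,25; 21: 22,26; 22: 27; 23: 25,26,30; 24: 26,27,39; 25: 27; 28: 29,33; 29: 30,34; 30: 35; 31: 33,34; 32: 34,35,37; 33: 35; 36: 37,38,39; 37: 42; 38: 64,92; 39: 78; 40: 41,45,71; 41: 42,46; 42: 47; 43: 45,46,51; 44: 46,47,49; 45: 47; 48: 49,50,51; 49: 54; 50: 52,60; 51: 68; 52: 53,57; 53: 54,58; 54: 59; 55: 57,58,62; 56: 58,59; 57: 59; 60: 61,65; 61: 62,66; 62: 67; 63: 65,66,70; 64: 66,67; 65: 67; 68: 69,73; 69: 70,74; 70: 75; 71: 73,74; 72: 74,75,108; 73: 75; 76: 77,81,107; 77: 78,82; 78: 83; 79: 81,82,87; 80: 82,83,85; 81: 83; 84: 85,86,87; 85: 90; 86: 88,96; 87: 104; 88: 89,93; 89: 90,94; 90: 95; 91: 93,94,98; 92: 94,95; 93: 95; 96: 97,101; 97: 98,102; 98: 103; 99: 101,102,106; 100: 102,103; 101: 103; 104: 105,109; 105: 106,110; 106: 111; 107: 109,110; 108: 110,111; 109: 111. *)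

theory Defs
  imports
    Complex_Main
    "HOL-Library.Extended_Nat"
    "HOL-Library.Word"
    "HOL-Algebra.Coset"
    "HOL-Algebra.Bij"
begin

section \<open>Graphs\<close>

text \<open>
  An undirected graph is a vertex set together with a set of edges, an edge being the set of
  its end vertices.  Colorings, connectivity and so on are used for simple graphs only.
\<close>

record 'v ugraph =
  verts :: "'v set"
  edges :: "'v set set"

definition simple_graph :: "'v ugraph \<Rightarrow> bool" where
  "simple_graph G \<longleftrightarrow> finite (verts G) \<and> (\<forall>e\<in>edges G. e \<subseteq> verts G \<and> card e = 2)"

definition incident :: "'v ugraph \<Rightarrow> 'v \<Rightarrow> 'v set set" where
  "incident G v = {e \<in> edges G. v \<in> e}"

definition cubic :: "'v ugraph \<Rightarrow> bool" where
  "cubic G \<longleftrightarrow> (\<forall>v\<in>verts G. card (incident G v) = 3)"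

definition reachable :: "'v ugraph \<Rightarrow> 'v \<Rightarrow> 'v \<Rightarrow> bool" where
  "reachable G u v \<longleftrightarrow> (u, v) \<in> {(x, y). {x, y} \<in> edges G}\<^sup>*"

definition connected_graph :: "'v ugraph \<Rightarrow> bool" where
  "connected_graph G \<longleftrightarrow> verts G \<noteq> {} \<and> (\<forall>u\<in>verts G. \<forall>v\<in>verts G. reachable G u v)"

definition delete_edges :: "'v ugraph \<Rightarrow> 'v set set \<Rightarrow> 'v ugraph" where
  "delete_edges G F = \<lparr>verts = verts G, edges = edges G - F\<rparr>"

definition delete_verts :: "'v ugraph \<Rightarrow> 'v set \<Rightarrow> 'v ugraph" where
  "delete_verts G S = \<lparr>verts = verts G - S, edges = {e \<in> edges G. e \<inter> S = {}}\<rparr>"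

definition is_bridge :: "'v ugraph \<Rightarrow> 'v set \<Rightarrow> bool" where
  "is_bridge G e \<longleftrightarrow> e \<in> edges G \<and> (\<exists>u\<in>e. \<exists>v\<in>e. \<not> reachable (delete_edges G {e}) u v)"

definition bridgeless :: "'v ugraph \<Rightarrow> bool" where
  "bridgeless G \<longleftrightarrow> (\<nexists>e. is_bridge G e)"

definition is_cycle :: "'v ugraph \<Rightarrow> 'v list \<Rightarrow> bool" where
  "is_cycle G vs \<longleftrightarrow> length vs \<ge> 3 \<and> distinct vs \<and> set vs \<subseteq> verts G \<and>
     (\<forall>i<length vs. {vs ! i, vs ! (Suc i mod length vs)} \<in> edges G)"

text \<open>The girth of an acyclic graph is \<open>\<infinity>\<close>.\<close>

definition girth :: "'v ugraph \<Rightarrow> enat" where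
  "girth G = (INF vs\<in>{vs. is_cycle G vs}. enat (length vs))"

text \<open>
  The infimum over natural numbers is the minimum.  A one-vertex graph gets edge-connectivity
  0 (its set of disconnecting edge sets is empty) and vertex-connectivity 0; leaving a single
  vertex counts as disconnecting, so that \<open>K\<^sub>n\<close> has vertex-connectivity \<open>n - 1\<close>.
\<close>

definition edge_connectivity :: "'v ugraph \<Rightarrow> nat" where
  "edge_connectivity G =
     Inf {card F |F. finite F \<and> F \<subseteq> edges G \<and> \<not> connected_graph (delete_edges G F)}"

definition vertex_connectivity :: "'v ugraph \<Rightarrow> nat" where
  "vertex_connectivity G =
     Inf {card S |S. finite S \<and> S \<subseteq> verts G \<and>
       (\<not> connected_graph (delete_verts G S) \<or> card (verts G - S) = 1)}"

definition is_graph_iso :: "('v \<Rightarrow> 'w) \<Rightarrow> 'v ugraph \<Rightarrow> 'w ugraph \<Rightarrow> bool" where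
  "is_graph_iso f G H \<longleftrightarrow> bij_betw f (verts G) (verts H) \<and>
     (\<forall>u\<in>verts G. \<forall>v\<in>verts G. {u, v} \<in> edges G \<longleftrightarrow> {f u, f v} \<in> edges H)"

definition isomorphic_graphs :: "'v ugraph \<Rightarrow> 'w ugraph \<Rightarrow> bool" where
  "isomorphic_graphs G H \<longleftrightarrow> (\<exists>f. is_graph_iso f G H)"

definition automorphism_group :: "'v ugraph \<Rightarrow> ('v \<Rightarrow> 'v) monoid" where
  "automorphism_group G =
     (BijGroup (verts G))\<lparr>carrier := {f \<in> Bij (verts G). is_graph_iso f G G}\<rparr>"

lemma group_automorphism_group: "group (automorphism_group G)"
proof -
  interpret B: group "BijGroup (verts G)" by (rule group_BijGroup)
  let ?A = "{f \<in> Bij (verts G). is_graph_iso f G G}"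
  have "subgroup ?A (BijGroup (verts G))"
  proof (rule B.subgroupI)
    show "?A \<subseteq> carrier (BijGroup (verts G))" by (auto simp: BijGroup_def)
    have "(\<lambda>x\<in>verts G. x) \<in> ?A"
      by (simp add: id_Bij is_graph_iso_def bij_betw_def inj_on_def)
    then show "?A \<noteq> {}" by blast
  next
    fix f assume f: "f \<in> ?A"
    then have bij: "bij_betw f (verts G) (verts G)" by (simp add: is_graph_iso_def)
    let ?g = "\<lambda>x\<in>verts G. inv_into (verts G) f x"
    have gB: "?g \<in> Bij (verts G)" using f by (simp add: restrict_inv_into_Bij)
    moreover have "is_graph_iso ?g G G"
      unfolding is_graph_iso_def
    proof (intro conjI ballI)
      show "bij_betw ?g (verts G) (verts G)" using gB by (simp add: Bij_def)
    next
      fix u v assume uv: "u \<in> verts G" "v \<in> verts G"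
      then have "inv_into (verts G) f u \<in> verts G" "inv_into (verts G) f v \<in> verts G"
        "f (inv_into (verts G) f u) = u" "f (inv_into (verts G) f v) = v"
        using bij by (auto simp: bij_betw_def inv_into_into f_inv_into_f)
      then show "{u, v} \<in> edges G \<longleftrightarrow> {?g u, ?g v} \<in> edges G"
        using f uv by (auto simp: is_graph_iso_def)
    qed
    ultimately show "inv\<^bsub>BijGroup (verts G)\<^esub> f \<in> ?A"
      using f by (simp add: inv_BijGroup)
  next
    fix f g assume fg: "f \<in> ?A" "g \<in> ?A"
    then have "g x \<in> verts G" if "x \<in> verts G" for x
      using that by (auto simp: is_graph_iso_def bij_betw_def)
    moreover have "compose (verts G) f g \<in> Bij (verts G)" using fg by (simp add: compose_Bij)
    ultimately show "f \<otimes>\<^bsub>BijGroup (verts G)\<^esub> g \<in> ?A"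
      using fg by (auto simp: BijGroup_def is_graph_iso_def compose_eq Bij_def)
  qed
  then show ?thesis
    unfolding automorphism_group_def by (rule B.subgroup_imp_group)
qed

text \<open>
  The dihedral group of order \<open>2 * n\<close>, generated by a rotation \<open>r\<close> and a reflection \<open>t\<close> with
  \<open>t * r\<^sup>k = r\<^sup>-\<^sup>k * t\<close>: the pair \<open>(k, s)\<close> stands for \<open>r\<^sup>k * t\<close> if \<open>s\<close>, and for \<open>r\<^sup>k\<close> otherwise.
\<close>

definition dihedral_group :: "nat \<Rightarrow> (int \<times> bool) monoid" where
  "dihedral_group n =
     \<lparr>carrier = {0..<int n} \<times> UNIV,
      mult = (\<lambda>(a, s) (b, t). ((if s then a - b else a + b) mod int n, s \<noteq> t)),
      one = (0, False)\<rparr>"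

lemma group_dihedral_group:
  assumes "n > 0"
  shows "group (dihedral_group n)"
proof (rule groupI)
  fix x assume "x \<in> carrier (dihedral_group n)"
  then obtain a s where x: "x = (a, s)" "0 \<le> a" "a < int n"
    by (auto simp: dihedral_group_def)
  let ?y = "(if s then a else (- a) mod int n, s)"
  have "?y \<in> carrier (dihedral_group n)"
    using x assms by (auto simp: dihedral_group_def)
  moreover have "?y \<otimes>\<^bsub>dihedral_group n\<^esub> x = \<one>\<^bsub>dihedral_group n\<^esub>"
    using x by (auto simp: dihedral_group_def mod_simps)
  ultimately show "\<exists>y\<in>carrier (dihedral_group n). y \<otimes>\<^bsub>dihedral_group n\<^esub> x = \<one>\<^bsub>dihedral_group n\<^esub>"
    by blast
qed (use assms in \<open>auto simp: dihedral_group_def mod_simps algebra_simps\<close>)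


section \<open>Colorings\<close>

definition is_H_coloring :: "'w ugraph \<Rightarrow> 'v ugraph \<Rightarrow> ('v set \<Rightarrow> 'w set) \<Rightarrow> bool" where
  "is_H_coloring H G \<phi> \<longleftrightarrow> \<phi> ` edges G \<subseteq> edges H \<and>
     (\<forall>v\<in>verts G. \<exists>w\<in>verts H. bij_betw \<phi> (incident G v) (incident H w))"

definition petersen_graph :: "nat set ugraph" where
  "petersen_graph =
     \<lparr>verts = {A. A \<subseteq> {0..4} \<and> card A = 2},
      edges = {{A, B} |A B. A \<subseteq> {0..4} \<and> card A = 2 \<and> B \<subseteq> {0..4} \<and> card B = 2 \<and> A \<inter> B = {}}\<rparr>"

definition is_petersen_coloring :: "'v ugraph \<Rightarrow> ('v set \<Rightarrow> nat set set) \<Rightarrow> bool" where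
  "is_petersen_coloring G \<phi> \<longleftrightarrow> is_H_coloring petersen_graph G \<phi>"

definition proper_edge_coloring :: "nat \<Rightarrow> 'v ugraph \<Rightarrow> ('v set \<Rightarrow> nat) \<Rightarrow> bool" where
  "proper_edge_coloring k G c \<longleftrightarrow> (\<forall>e\<in>edges G. c e < k) \<and>
     (\<forall>e\<in>edges G. \<forall>f\<in>edges G. e \<noteq> f \<and> e \<inter> f \<noteq> {} \<longrightarrow> c e \<noteq> c f)"

definition normal_5_edge_coloring :: "'v ugraph \<Rightarrow> ('v set \<Rightarrow> nat) \<Rightarrow> bool" where
  "normal_5_edge_coloring G c \<longleftrightarrow> proper_edge_coloring 5 G c \<and>
     (\<forall>u v. {u, v} \<in> edges G \<longrightarrow> card (c ` (incident G u \<union> incident G v)) \<in> {3, 5})"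


section \<open>Normalized sorted edge list\<close>

fun decimal :: "nat \<Rightarrow> string" where
  "decimal n = (if n < 10 then [''0123456789'' ! n]
     else decimal (n div 10) @ [''0123456789'' ! (n mod 10)])"

declare decimal.simps [simp del]

fun comma_separated :: "string list \<Rightarrow> string" where
  "comma_separated [] = []"
| "comma_separated [s] = s"
| "comma_separated (s # t # ss) = s @ '','' @ comma_separated (t # ss)"

definition json_array :: "string list \<Rightarrow> string" where
  "json_array ss = ''['' @ comma_separated ss @ '']''"

text \<open>The list comprehension enumerates the pairs in lexicographic order.\<close>

definition sorted_edge_list :: "nat ugraph \<Rightarrow> (nat \<times> nat) list" where
  "sorted_edge_list G =
     [(u, v). u \<leftarrow> sorted_list_of_set (verts G), v \<leftarrow> sorted_list_of_set (verts G),
        u < v \<and> {u, v} \<in> edges G]"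

lemma set_sorted_edge_list:
  assumes "simple_graph G"
  shows "set (sorted_edge_list G) = {(u, v). u < v \<and> {u, v} \<in> edges G}"
  using assms by (force simp: sorted_edge_list_def simple_graph_def)

definition normalized_edge_list :: "nat ugraph \<Rightarrow> string" where
  "normalized_edge_list G =
     json_array (map (\<lambda>(u, v). json_array [decimal u, decimal v]) (sorted_edge_list G))"

definition ascii_bytes :: "string \<Rightarrow> 8 word list" where
  "ascii_bytes s = map of_char s"


section \<open>SHA-256 (FIPS 180-4)\<close>

context
  includes bit_operations_syntax
begin

definition sha_Ch :: "32 word \<Rightarrow> 32 word \<Rightarrow> 32 word \<Rightarrow> 32 word" where
  "sha_Ch x y z = (x AND y) XOR (NOT x AND z)"

definition sha_Maj :: "32 word \<Rightarrow> 32 word \<Rightarrow> 32 word \<Rightarrow> 32 word" where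
  "sha_Maj x y z = (x AND y) XOR (x AND z) XOR (y AND z)"

definition sha_Sigma0 :: "32 word \<Rightarrow> 32 word" where
  "sha_Sigma0 x = word_rotr 2 x XOR word_rotr 13 x XOR word_rotr 22 x"

definition sha_Sigma1 :: "32 word \<Rightarrow> 32 word" where
  "sha_Sigma1 x = word_rotr 6 x XOR word_rotr 11 x XOR word_rotr 25 x"

definition sha_sigma0 :: "32 word \<Rightarrow> 32 word" where
  "sha_sigma0 x = word_rotr 7 x XOR word_rotr 18 x XOR drop_bit 3 x"

definition sha_sigma1 :: "32 word \<Rightarrow> 32 word" where
  "sha_sigma1 x = word_rotr 17 x XOR word_rotr 19 x XOR drop_bit 10 x"

end

definition sha_K :: "32 word list" where
  "sha_K =
    [0x428a2f98, 0x71374491, 0xb5c0fbcf, 0xe9b5dba5, 0x3956c25b, 0x59f111f1, 0x923f82a4,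
     0xab1c5ed5, 0xd807aa98, 0x12835b01, 0x243185be, 0x550c7dc3, 0x72be5d74, 0x80deb1fe,
     0x9bdc06a7, 0xc19bf174, 0xe49b69c1, 0xefbe4786, 0x0fc19dc6, 0x240ca1cc, 0x2de92c6f,
     0x4a7484aa, 0x5cb0a9dc, 0x76f988da, 0x983e5152, 0xa831c66d, 0xb00327c8, 0xbf597fc7,
     0xc6e00bf3, 0xd5a79147, 0x06ca6351, 0x14292967, 0x27b70a85, 0x2e1b2138, 0x4d2c6dfc,
     0x53380d13, 0x650a7354, 0x766a0abb, 0x81c2c92e, 0x92722c85, 0xa2bfe8a1, 0xa81a664b,
     0xc24b8b70, 0xc76c51a3, 0xd192e819, 0xd6990624, 0xf40e3585, 0x106aa070, 0x19a4c116,
     0x1e376c08, 0x2748774c, 0x34b0bcb5, 0x391c0cb3, 0x4ed8aa4a, 0x5b9cca4f, 0x682e6ff3,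
     0x748f82ee, 0x78a5636f, 0x84c87814, 0x8cc70208, 0x90befffa, 0xa4506ceb, 0xbef9a3f7,
     0xc67178f2]"

definition sha_init :: "32 word list" where
  "sha_init =
    [0x6a09e667, 0xbb67ae85, 0x3c6ef372, 0xa54ff53a, 0x510e527f, 0x9b05688c, 0x1f83d9ab,
     0x5be0cd19]"

definition big_endian_bytes :: "nat \<Rightarrow> 'a::len word \<Rightarrow> 8 word list" where
  "big_endian_bytes n w = map (\<lambda>i. ucast (drop_bit (8 * i) w)) (rev [0..<n])"

definition sha_pad :: "8 word list \<Rightarrow> 8 word list" where
  "sha_pad m = m @ [0x80] @ replicate ((119 - length m mod 64) mod 64) 0 @
     big_endian_bytes 8 (of_nat (8 * length m) :: 64 word)"

fun chunks :: "nat \<Rightarrow> 'a list \<Rightarrow> 'a list list" where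
  "chunks n xs = (if n = 0 \<or> xs = [] then [] else take n xs # chunks n (drop n xs))"

declare chunks.simps [simp del]

definition sha_blocks :: "8 word list \<Rightarrow> 32 word list list" where
  "sha_blocks m = map (\<lambda>block. map word_rcat (chunks 4 block)) (chunks 64 (sha_pad m))"

definition sha_extend :: "32 word list \<Rightarrow> 32 word list" where
  "sha_extend ws = (let t = length ws in
     ws @ [sha_sigma1 (ws ! (t - 2)) + ws ! (t - 7) + sha_sigma0 (ws ! (t - 15)) + ws ! (t - 16)])"

definition sha_schedule :: "32 word list \<Rightarrow> 32 word list" where
  "sha_schedule block = (sha_extend ^^ 48) block"

text \<open>Both kinds of state are lists of length 8, so the default branch is never taken.\<close>

definition sha_round :: "32 word \<times> 32 word \<Rightarrow> 32 word list \<Rightarrow> 32 word list" where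
  "sha_round kw s = (case (kw, s) of
     ((k, w), [a, b, c, d, e, f, g, h]) \<Rightarrow>
       (let t1 = h + sha_Sigma1 e + sha_Ch e f g + k + w;
            t2 = sha_Sigma0 a + sha_Maj a b c
        in [t1 + t2, a, b, c, d + t1, e, f, g])
   | _ \<Rightarrow> s)"

definition sha_compress :: "32 word list \<Rightarrow> 32 word list \<Rightarrow> 32 word list" where
  "sha_compress block s = map2 (+) s (fold sha_round (zip sha_K (sha_schedule block)) s)"

definition sha256 :: "8 word list \<Rightarrow> 8 word list" where
  "sha256 m = concat (map (big_endian_bytes 4) (fold sha_compress (sha_blocks m) sha_init))"

definition hex_string :: "8 word list \<Rightarrow> string" where
  "hex_string bs = concat (map (\<lambda>b. [''0123456789abcdef'' ! (unat b div 16),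
     ''0123456789abcdef'' ! (unat b mod 16)]) bs)"


section \<open>The graph $H$\<close>

text \<open>Entry \<open>j\<close> of the list of semiedges is the vertex incident with semiedge \<open>j\<close>.\<close>

record multipole =
  pole_verts :: "nat set"
  pole_edges :: "(nat \<times> nat) list"
  pole_semiedges :: "nat list"

definition Q :: multipole where
  "Q = \<lparr>pole_verts = {0..35},
    pole_edges =
    [(0, 1), (0, 5), (1, 2), (1, 6), (2, 7), (3, 5), (3, 6), (4, 6), (4, 7), (5, 7), (8, 9),
     (8, 10), (8, 11), (9, 14), (10, 12), (11, 28), (12, 13), (12, 17), (13, 14), (13, 18),
     (14, 19), (15, 17), (15, 18), (15, 22), (16, 18), (16, 19), (17, 19), (20, 21), (20,
     25), (21, 22), (21, 26), (22, 27), (23, 25), (23, 26), (23, 30), (24, 26), (24, 27),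
     (25, 27), (28, 29), (28, 33), (29, 30), (29, 34), (30, 35), (31, 33), (31, 34), (32,
     34), (32, 35), (33, 35), (0, 31), (3, 11), (4, 9), (10, 20)],
    pole_semiedges = [2, 32, 24, 16]\<rparr>"

definition Q_label :: "nat \<Rightarrow> nat \<Rightarrow> nat" where
  "Q_label i v = 36 * i + v"

definition center :: nat where
  "center = 108"

definition leaf :: "nat \<Rightarrow> nat" where
  "leaf i = 109 + i"

text \<open>
  The constructor \<open>Semi i j\<close> is the semiedge \<open>j\<close> of the copy \<open>i\<close> of \<open>Q\<close>.
  Every join of two such objects (semiedges or vertices) produces an edge.
\<close>

datatype joinable = Semi nat nat | Vertex nat

fun join_vertex :: "joinable \<Rightarrow> nat" where
  "join_vertex (Semi i j) = Q_label i (pole_semiedges Q ! j)"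
| "join_vertex (Vertex v) = v"

definition H_joins :: "(joinable \<times> joinable) list" where
  "H_joins = concat (map (\<lambda>i. let i' = (i + 1) mod 3 in
     [(Semi i 0, Semi i' 3),
      (Semi i 2, Vertex (leaf i)),
      (Vertex (leaf i), Semi i' 1),
      (Vertex center, Vertex (leaf i))]) [0..<3])"

text \<open>All edges produced by the construction, with multiplicity.\<close>

definition H_edge_list :: "nat set list" where
  "H_edge_list =
     concat (map (\<lambda>i. map (\<lambda>(u, v). {Q_label i u, Q_label i v}) (pole_edges Q)) [0..<3]) @
     map (\<lambda>(x, y). {join_vertex x, join_vertex y}) H_joins"

definition graph_H :: "nat ugraph" where
  "graph_H =
     \<lparr>verts = (\<Union>i<3. Q_label i ` pole_verts Q) \<union> {center} \<union> leaf ` {..<3},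
      edges = set H_edge_list\<rparr>"


section \<open>The graph $G$\<close>

definition G_larger_neighbours :: "(nat \<times> nat list) list" where
  "G_larger_neighbours =
    [(0, [1, 5, 31]), (1, [2, 6]), (2, [7, 100]), (3, [5, 6, 11]), (4, [6, 7, 9]), (5, [7]),
     (8, [9, 10, 11]), (9, [14]), (10, [12, 20]), (11, [28]), (12, [13, 17]), (13, [14, 18]),
     (14, [19]), (15, [17, 18, 22]), (16, [18, 19, 56]), (17, [19]), (20, [21, 25]), (21,
     [22, 26]), (22, [27]), (23, [25, 26, 30]), (24, [26, 27, 39]), (25, [27]), (28, [29,
     33]), (29, [30, 34]), (30, [35]), (31, [33, 34]), (32, [34, 35, 37]), (33, [35]), (36,
     [37, 38, 39]), (37, [42]), (38, [64, 92]), (39, [78]), (40, [41, 45, 71]), (41, [42,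
     46]), (42, [47]), (43, [45, 46, 51]), (44, [46, 47, 49]), (45, [47]), (48, [49, 50,
     51]), (49, [54]), (50, [52, 60]), (51, [68]), (52, [53, 57]), (53, [54, 58]), (54,
     [59]), (55, [57, 58, 62]), (56, [58, 59]), (57, [59]), (60, [61, 65]), (61, [62, 66]),
     (62, [67]), (63, [65, 66, 70]), (64, [66, 67]), (65, [67]), (68, [69, 73]), (69, [70,
     74]), (70, [75]), (71, [73, 74]), (72, [74, 75, 108]), (73, [75]), (76, [77, 81, 107]),
     (77, [78, 82]), (78, [83]), (79, [81, 82, 87]), (80, [82, 83, 85]), (81, [83]), (84,
     [85, 86, 87]), (85, [90]), (86, [88, 96]), (87, [104]), (88, [89, 93]), (89, [90, 94]),
     (90, [95]), (91, [93, 94, 98]), (92, [94, 95]), (93, [95]), (96, [97, 101]), (97, [98,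
     102]), (98, [103]), (99, [101, 102, 106]), (100, [102, 103]), (101, [103]), (104, [105,
     109]), (105, [106, 110]), (106, [111]), (107, [109, 110]), (108, [110, 111]), (109,
     [111])]"

definition graph_G :: "nat ugraph" where
  "graph_G =
     \<lparr>verts = {0..111},
      edges = {{u, v} |u v vs. (u, vs) \<in> set G_larger_neighbours \<and> v \<in> set vs}\<rparr>"

end

theory Submission
  imports Defs
begin

text \<open>
  Connectivity: from every vertex other than the leaves there are three walks to the three leaves
  that meet only at their start, and any two leaves are joined by three internally disjoint walks.
  Deleting two edges or two vertices leaves one of the three walks intact.

  Automorphisms: in a connected graph an embedding is determined step by step along a search order of
  the vertices, with at most three choices per step; the many pentagons make almost all branches die
  early.  The search of \<open>graph_H\<close> in itself yields six maps, the one in \<open>graph_G\<close> none.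

  Colorings: a Petersen coloring gives a normal 5-edge-coloring, since the edge \<open>{A, B}\<close> of the
  Petersen graph can be colored by the element missing from \<open>A \<union> B\<close>.  In a normal 5-edge-coloring,
  the states at the semiedges of a four-pole satisfy a relation that is invariant under permutations
  of the colors.  Computing this relation first for the Petersen graph without two adjacent vertices
  and then for \<open>Q\<close> leaves a small search, which shows that the relations of the three copies
  of \<open>Q\<close> are not compatible.
\<close>

section \<open>Adjacency\<close>

text \<open>Every finite check is done by rewriting inside the logic, and this dictates the form of
  the definitions. Adjacency is a table with one rewrite rule per vertex. The searches are restated
  so that a branch is unfolded only after its condition has been decided. Words are lists of truth
  values, on which a rotation merely rearranges the entries. The searches have to be complete: a
  general lemma shows that every isomorphism, or the darts of every normal coloring, occur in the
  output, which is then inspected. The automorphisms found are confirmed separately. Symmetry keeps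
  the tables small. The rotation of the three copies of \<open>Q\<close> carries the walks for 36
  vertices to all 108. The permutations of the five colors act transitively on the 30 possible
  states of a semiedge (a color and an unordered pair of further colors), so the behaviour of a
  block for one state at its first semiedge determines it for all. With blocks, the search branches
  over the rows of a table instead of the colors of all edges.\<close>

definition neighbours :: "(nat \<times> nat) list \<Rightarrow> nat \<Rightarrow> nat list" where
  "neighbours ps u =
     sort (concat (map (\<lambda>(a, b). if a = u then [b] else if b = u then [a] else []) ps))"

lemma mem_neighbours:
  "v \<in> set (neighbours ps u) \<longleftrightarrow> {u, v} \<in> (\<lambda>(a, b). {a, b}) ` set ps"
proof -
  have "v \<in> set (case p of (a, b) \<Rightarrow> if a = u then [b] else if b = u then [a] else []) \<longleftrightarrow>
      {u, v} = (case p of (a, b) \<Rightarrow> {a, b})" for p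
    by (cases p) (auto simp: doubleton_eq_iff)
  then show ?thesis by (simp add: neighbours_def image_iff)
qed

text \<open>Unlike the sets in \<open>H_edge_list\<close>, pairs can be taken apart by pattern
  matching, as \<open>neighbours\<close> does.\<close>

definition H_pairs :: "(nat \<times> nat) list" where
  "H_pairs =
     concat (map (\<lambda>i. map (\<lambda>(u, v). (Q_label i u, Q_label i v)) (pole_edges Q)) [0..<3]) @
     map (\<lambda>(x, y). (join_vertex x, join_vertex y)) H_joins"

definition G_pairs :: "(nat \<times> nat) list" where
  "G_pairs = concat (map (\<lambda>(u, vs). map (Pair u) vs) G_larger_neighbours)"

lemma H_edge_list_pairs: "H_edge_list = map (\<lambda>(u, v). {u, v}) H_pairs"
  by (simp add: H_edge_list_def H_pairs_def map_concat comp_def case_prod_unfold)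

lemma edges_H_pairs: "edges graph_H = (\<lambda>(u, v). {u, v}) ` set H_pairs"
  by (simp add: graph_H_def H_edge_list_pairs)

lemma edges_G_pairs: "edges graph_G = (\<lambda>(u, v). {u, v}) ` set G_pairs"
proof (rule Set.set_eqI)
  fix e
  have "e \<in> edges graph_G \<longleftrightarrow>
      (\<exists>(u, vs)\<in>set G_larger_neighbours. \<exists>v\<in>set vs. e = {u, v})"
    unfolding graph_G_def by auto
  also have "\<dots> \<longleftrightarrow> e \<in> (\<lambda>(u, v). {u, v}) ` set G_pairs"
    unfolding G_pairs_def by (simp add: image_iff Bex_def case_prod_beta) blast
  finally show "e \<in> edges graph_G \<longleftrightarrow> e \<in> (\<lambda>(u, v). {u, v}) ` set G_pairs" .
qed

abbreviation adj_H :: "nat \<Rightarrow> nat list" where "adj_H \<equiv> neighbours H_pairs"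
abbreviation adj_G :: "nat \<Rightarrow> nat list" where "adj_G \<equiv> neighbours G_pairs"

lemma edge_H_iff: "{u, v} \<in> edges graph_H \<longleftrightarrow> v \<in> set (adj_H u)"
  by (simp add: mem_neighbours edges_H_pairs)

lemma edge_G_iff: "{u, v} \<in> edges graph_G \<longleftrightarrow> v \<in> set (adj_G u)"
  by (simp add: mem_neighbours edges_G_pairs)

lemma verts_H: "verts graph_H = {..<112}"
proof -
  have three: "{..<3} = {0, 1, 2 :: nat}" by auto
  have "Q_label i ` {0..35} = {36 * i..36 * i + 35}" for i
    by (simp add: Q_label_def [abs_def] add.commute)
  then show ?thesis
    by (auto simp: graph_H_def three Q_def center_def leaf_def)
qed

lemma verts_G: "verts graph_G = {..<112}"
  by (auto simp: graph_G_def)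

lemma upt_3: "[0..<3] = [0, 1, 2]"
  by (simp add: upt_rec)

lemma upt_112: "[0..<112] =
    [0, 1, 2, 3, 4, 5, 6, 7, 8, 9, 10, 11, 12, 13, 14, 15, 16, 17, 18, 19, 20, 21, 22, 23, 24,
     25, 26, 27, 28, 29, 30, 31, 32, 33, 34, 35, 36, 37, 38, 39, 40, 41, 42, 43, 44, 45, 46, 47,
     48, 49, 50, 51, 52, 53, 54, 55, 56, 57, 58, 59, 60, 61, 62, 63, 64, 65, 66, 67, 68, 69, 70,
     71, 72, 73, 74, 75, 76, 77, 78, 79, 80, 81, 82, 83, 84, 85, 86, 87, 88, 89, 90, 91, 92, 93,
     94, 95, 96, 97, 98, 99, 100, 101, 102, 103, 104, 105, 106, 107, 108, 109, 110, 111]"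
  by (simp add: upt_rec)

lemma H_pairs_eval: "H_pairs =
    [(0, 1), (0, 5), (1, 2), (1, 6), (2, 7), (3, 5), (3, 6), (4, 6), (4, 7), (5, 7), (8, 9), (8,
     10), (8, 11), (9, 14), (10, 12), (11, 28), (12, 13), (12, 17), (13, 14), (13, 18), (14,
     19), (15, 17), (15, 18), (15, 22), (16, 18), (16, 19), (17, 19), (20, 21), (20, 25), (21,
     22), (21, 26), (22, 27), (23, 25), (23, 26), (23, 30), (24, 26), (24, 27), (25, 27), (28,
     29), (28, 33), (29, 30), (29, 34), (30, 35), (31, 33), (31, 34), (32, 34), (32, 35), (33,
     35), (0, 31), (3, 11), (4, 9), (10, 20), (36, 37), (36, 41), (37, 38), (37, 42), (38, 43),
     (39, 41), (39, 42), (40, 42), (40, 43), (41, 43), (44, 45), (44, 46), (44, 47), (45, 50),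
     (46, 48), (47, 64), (48, 49), (48, 53), (49, 50), (49, 54), (50, 55), (51, 53), (51, 54),
     (51, 58), (52, 54), (52, 55), (53, 55), (56, 57), (56, 61), (57, 58), (57, 62), (58, 63),
     (59, 61), (59, 62), (59, 66), (60, 62), (60, 63), (61, 63), (64, 65), (64, 69), (65, 66),
     (65, 70), (66, 71), (67, 69), (67, 70), (68, 70), (68, 71), (69, 71), (36, 67), (39, 47),
     (40, 45), (46, 56), (72, 73), (72, 77), (73, 74), (73, 78), (74, 79), (75, 77), (75, 78),
     (76, 78), (76, 79), (77, 79), (80, 81), (80, 82), (80, 83), (81, 86), (82, 84), (83, 100),
     (84, 85), (84, 89), (85, 86), (85, 90), (86, 91), (87, 89), (87, 90), (87, 94), (88, 90),
     (88, 91), (89, 91), (92, 93), (92, 97), (93, 94), (93, 98), (94, 99), (95, 97), (95, 98),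
     (95, 102), (96, 98), (96, 99), (97, 99), (100, 101), (100, 105), (101, 102), (101, 106),
     (102, 107), (103, 105), (103, 106), (104, 106), (104, 107), (105, 107), (72, 103), (75,
     83), (76, 81), (82, 92), (2, 52), (24, 109), (109, 68), (108, 109), (38, 88), (60, 110),
     (110, 104), (108, 110), (74, 16), (96, 111), (111, 32), (108, 111)]"
  by (simp add: H_pairs_def Q_def Q_label_def H_joins_def leaf_def center_def upt_3)

lemma adj_H_table: "map adj_H [0..<112] =
    [[1, 5, 31], [0, 2, 6], [1, 7, 52], [5, 6, 11], [6, 7, 9], [0, 3, 7], [1, 3, 4], [2, 4, 5],
     [9, 10, 11], [4, 8, 14], [8, 12, 20], [3, 8, 28], [10, 13, 17], [12, 14, 18], [9, 13, 19],
     [17, 18, 22], [18, 19, 74], [12, 15, 19], [13, 15, 16], [14, 16, 17], [10, 21, 25], [20,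
     22, 26], [15, 21, 27], [25, 26, 30], [26, 27, 109], [20, 23, 27], [21, 23, 24], [22, 24,
     25], [11, 29, 33], [28, 30, 34], [23, 29, 35], [0, 33, 34], [34, 35, 111], [28, 31, 35],
     [29, 31, 32], [30, 32, 33], [37, 41, 67], [36, 38, 42], [37, 43, 88], [41, 42, 47], [42,
     43, 45], [36, 39, 43], [37, 39, 40], [38, 40, 41], [45, 46, 47], [40, 44, 50], [44, 48,
     56], [39, 44, 64], [46, 49, 53], [48, 50, 54], [45, 49, 55], [53, 54, 58], [2, 54, 55],
     [48, 51, 55], [49, 51, 52], [50, 52, 53], [46, 57, 61], [56, 58, 62], [51, 57, 63], [61,
     62, 66], [62, 63, 110], [56, 59, 63], [57, 59, 60], [58, 60, 61], [47, 65, 69], [64, 66,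
     70], [59, 65, 71], [36, 69, 70], [70, 71, 109], [64, 67, 71], [65, 67, 68], [66, 68, 69],
     [73, 77, 103], [72, 74, 78], [16, 73, 79], [77, 78, 83], [78, 79, 81], [72, 75, 79], [73,
     75, 76], [74, 76, 77], [81, 82, 83], [76, 80, 86], [80, 84, 92], [75, 80, 100], [82, 85,
     89], [84, 86, 90], [81, 85, 91], [89, 90, 94], [38, 90, 91], [84, 87, 91], [85, 87, 88],
     [86, 88, 89], [82, 93, 97], [92, 94, 98], [87, 93, 99], [97, 98, 102], [98, 99, 111], [92,
     95, 99], [93, 95, 96], [94, 96, 97], [83, 101, 105], [100, 102, 106], [95, 101, 107], [72,
     105, 106], [106, 107, 110], [100, 103, 107], [101, 103, 104], [102, 104, 105], [109, 110,
     111], [24, 68, 108], [60, 104, 108], [32, 96, 108]]"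
  by (simp add: neighbours_def H_pairs_eval upt_112)

lemma adj_G_table: "map adj_G [0..<112] =
    [[1, 5, 31], [0, 2, 6], [1, 7, 100], [5, 6, 11], [6, 7, 9], [0, 3, 7], [1, 3, 4], [2, 4, 5],
     [9, 10, 11], [4, 8, 14], [8, 12, 20], [3, 8, 28], [10, 13, 17], [12, 14, 18], [9, 13, 19],
     [17, 18, 22], [18, 19, 56], [12, 15, 19], [13, 15, 16], [14, 16, 17], [10, 21, 25], [20,
     22, 26], [15, 21, 27], [25, 26, 30], [26, 27, 39], [20, 23, 27], [21, 23, 24], [22, 24,
     25], [11, 29, 33], [28, 30, 34], [23, 29, 35], [0, 33, 34], [34, 35, 37], [28, 31, 35],
     [29, 31, 32], [30, 32, 33], [37, 38, 39], [32, 36, 42], [36, 64, 92], [24, 36, 78], [41,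
     45, 71], [40, 42, 46], [37, 41, 47], [45, 46, 51], [46, 47, 49], [40, 43, 47], [41, 43,
     44], [42, 44, 45], [49, 50, 51], [44, 48, 54], [48, 52, 60], [43, 48, 68], [50, 53, 57],
     [52, 54, 58], [49, 53, 59], [57, 58, 62], [16, 58, 59], [52, 55, 59], [53, 55, 56], [54,
     56, 57], [50, 61, 65], [60, 62, 66], [55, 61, 67], [65, 66, 70], [38, 66, 67], [60, 63,
     67], [61, 63, 64], [62, 64, 65], [51, 69, 73], [68, 70, 74], [63, 69, 75], [40, 73, 74],
     [74, 75, 108], [68, 71, 75], [69, 71, 72], [70, 72, 73], [77, 81, 107], [76, 78, 82], [39,
     77, 83], [81, 82, 87], [82, 83, 85], [76, 79, 83], [77, 79, 80], [78, 80, 81], [85, 86,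
     87], [80, 84, 90], [84, 88, 96], [79, 84, 104], [86, 89, 93], [88, 90, 94], [85, 89, 95],
     [93, 94, 98], [38, 94, 95], [88, 91, 95], [89, 91, 92], [90, 92, 93], [86, 97, 101], [96,
     98, 102], [91, 97, 103], [101, 102, 106], [2, 102, 103], [96, 99, 103], [97, 99, 100], [98,
     100, 101], [87, 105, 109], [104, 106, 110], [99, 105, 111], [76, 109, 110], [72, 110, 111],
     [104, 107, 111], [105, 107, 108], [106, 108, 109]]"
  by (simp add: neighbours_def G_pairs_def G_larger_neighbours_def upt_112)

text \<open>Comparing the lists entry by entry turns each table into 112 unconditional rewrite
  rules.\<close>

lemmas adj_H_simps = adj_H_table [simplified upt_112 list.map list.inject simp_thms]
lemmas adj_G_simps = adj_G_table [simplified upt_112 list.map list.inject simp_thms]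

section \<open>Automorphisms\<close>

fun avoids :: "'a \<Rightarrow> 'a list \<Rightarrow> nat list \<Rightarrow> bool" where
  "avoids x m [] \<longleftrightarrow> True"
| "avoids x m (d # ds) \<longleftrightarrow> x \<noteq> m ! d \<and> avoids x m ds"

fun joins :: "('a \<Rightarrow> 'a list) \<Rightarrow> 'a \<Rightarrow> 'a list \<Rightarrow> nat list \<Rightarrow> bool" where
  "joins adj x m [] \<longleftrightarrow> True"
| "joins adj x m (b # bs) \<longleftrightarrow> x \<in> set (adj (m ! b)) \<and> joins adj x m bs"

lemma avoids_iff: "avoids x m ds \<longleftrightarrow> (\<forall>d\<in>set ds. x \<noteq> m ! d)"
  by (induction ds) auto

lemma joins_iff: "joins adj x m bs \<longleftrightarrow> (\<forall>b\<in>set bs. x \<in> set (adj (m ! b)))"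
  by (induction bs) auto

text \<open>
  A step \<open>(v, p, bs, ds)\<close> places the vertex \<open>v\<close> next to the vertex at position \<open>p\<close>; the lists \<open>bs\<close> and
  \<open>ds\<close> are the positions of the other neighbours of \<open>v\<close> and of the neighbours of the vertex at \<open>p\<close>.
  Positions are counted from the vertex placed last.
\<close>

fun extend :: "('b \<Rightarrow> 'b list) \<Rightarrow> ('a \<times> nat \<times> nat list \<times> nat list) list \<Rightarrow> 'b list \<Rightarrow> 'b list list"
where
  "extend adj [] m = [m]"
| "extend adj ((v, p, bs, ds) # steps) m =
     concat (map (\<lambda>x. if avoids x m ds \<and> joins adj x m bs
       then extend adj steps (x # m) else []) (adj (m ! p)))"

text \<open>Checked once on the source graph: it makes the tests in \<open>extend\<close> necessary
  conditions for an embedding.\<close>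

fun valid_plan :: "('a \<Rightarrow> 'a list) \<Rightarrow> ('a \<times> nat \<times> nat list \<times> nat list) list \<Rightarrow> 'a list \<Rightarrow> bool" where
  "valid_plan adj [] vs \<longleftrightarrow> True"
| "valid_plan adj ((v, p, bs, ds) # steps) vs \<longleftrightarrow>
     p < length vs \<and> v \<in> set (adj (vs ! p)) \<and>
     list_all (\<lambda>d. d < length vs) ds \<and> avoids v vs ds \<and>
     list_all (\<lambda>b. b < length vs) bs \<and> joins adj v vs bs \<and>
     valid_plan adj steps (v # vs)"

text \<open>At every step \<open>f v\<close> is one of the candidates: it is adjacent to the image
  of the parent, injectivity passes \<open>avoids\<close>, and preservation of edges passes
  \<open>joins\<close>. Since \<open>avoids\<close> looks only at the positions in
  \<open>ds\<close>, the output may be larger than the set of embeddings; what counts is that none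
  is lost.\<close>

lemma embedding_in_extend:
  assumes "valid_plan adj steps vs"
    and "inj_on f V" and "set vs \<subseteq> V" and "fst ` set steps \<subseteq> V"
    and hom: "\<And>u v. u \<in> V \<Longrightarrow> v \<in> V \<Longrightarrow> v \<in> set (adj u) \<Longrightarrow> f v \<in> set (adj' (f u))"
  shows "map f (rev (map fst steps) @ vs) \<in> set (extend adj' steps (map f vs))"
  using assms(1,3,4)
proof (induction steps arbitrary: vs)
  case (Cons step steps)
  obtain v p bs ds where step: "step = (v, p, bs, ds)" by (cases step)
  have v: "v \<in> V" and in_V: "vs ! i \<in> V" if "i < length vs" for i
    using Cons.prems step that by (auto simp: subset_iff)
  have v: "v \<in> V" using Cons.prems step by auto
  have "f v \<in> set (adj' (map f vs ! p))"
    using Cons.prems(1) step in_V v hom by simp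
  moreover have "avoids (f v) (map f vs) ds"
    using Cons.prems(1) step in_V v inj_onD [OF assms(2)] by (fastforce simp: list_all_iff avoids_iff)
  moreover have "joins adj' (f v) (map f vs) bs"
    using Cons.prems(1) step in_V v hom by (auto simp: list_all_iff joins_iff)
  moreover have "map f (rev (map fst steps) @ v # vs) \<in> set (extend adj' steps (map f (v # vs)))"
    using Cons.prems step v by (intro Cons.IH) auto
  ultimately show ?case
    by (auto simp: step intro!: bexI [of _ "f v"])
qed simp

text \<open>The order starts at the vertex 2, whose image is chosen freely. The first five vertices
  2, 7, 1, 5, 0 form a pentagon, so the search is constrained from the start. A nonempty third
  component marks a vertex that closes a cycle with earlier ones.\<close>

definition plan :: "(nat \<times> nat \<times> nat list \<times> nat list) list" where
  "plan =
    [(7, 0, [], []), (1, 1, [], [0]), (5, 1, [], [2]), (0, 0, [1], [2]), (6, 2, [], [0, 4]), (3,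
     0, [2], [3]), (4, 1, [5], [0, 4]), (11, 1, [], [2, 4]), (9, 1, [], [3, 7]), (8, 0, [1],
     [2]), (31, 6, [], [7, 8]), (28, 3, [], [1, 5]), (33, 0, [1], [4]), (29, 1, [], [0, 5]),
     (34, 0, [3], [2]), (35, 2, [], [3, 4]), (32, 0, [1], [3]), (30, 1, [3], [0, 4]), (111, 1,
     [], [2, 3]), (10, 9, [], [10, 11]), (14, 11, [], [10, 13]), (12, 1, [], [11]), (13, 0, [1],
     [2]), (17, 1, [], [0, 3]), (19, 0, [3], [2]), (18, 2, [], [3, 4]), (15, 0, [2], [3]), (16,
     1, [2], [0, 4]), (20, 8, [], [6, 18]), (23, 11, [], [13, 15]), (25, 0, [1], [12]), (22, 4,
     [], [5, 7]), (21, 0, [3], [5]), (26, 0, [3], [1, 4]), (27, 2, [3], [1, 7]), (24, 0, [1],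
     [3, 4]), (109, 0, [], [1, 2]), (108, 0, [18], [1]), (52, 38, [], [36, 37]), (110, 1, [],
     [2, 20]), (74, 12, [], [14, 15]), (96, 22, [], [3, 24]), (55, 3, [], [42]), (54, 4, [], [0,
     43]), (49, 0, [], [5]), (50, 0, [2], [1]), (53, 3, [], [0, 7]), (48, 0, [2], [4]), (51, 1,
     [4], [0, 5]), (45, 3, [], [4, 6]), (46, 2, [], [3, 5]), (44, 0, [1], [3]), (58, 3, [], [5,
     8]), (60, 13, [], [15]), (63, 0, [1], [14]), (57, 2, [], [0, 6]), (56, 0, [5], [3]), (62,
     1, [3], [0, 4]), (61, 1, [3], [2, 7]), (59, 0, [1], [2, 4]), (68, 23, [], [22, 24]), (66,
     1, [], [2, 3]), (71, 0, [1], [2]), (65, 1, [], [0, 3]), (70, 0, [3], [2]), (69, 2, [], [3,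
     4]), (64, 0, [2], [3]), (67, 1, [2], [0, 4]), (47, 1, [16], [2, 4]), (39, 0, [], [2, 17]),
     (40, 20, [], [18, 24]), (42, 0, [1], [21]), (41, 2, [], [0, 3]), (36, 0, [5], [3]), (37, 0,
     [2], [1, 6]), (43, 2, [4], [1, 5]), (38, 0, [1], [3, 5]), (104, 37, [], [23, 39]), (107, 0,
     [], [38]), (102, 0, [], [1]), (95, 0, [], [1]), (98, 0, [39], [1]), (106, 4, [], [3, 42]),
     (101, 0, [3], [5]), (105, 5, [], [4, 6]), (103, 0, [2], [6]), (100, 1, [2], [0, 7]), (99,
     45, [], [5, 68]), (97, 0, [7], [46]), (93, 7, [], [8, 47]), (92, 0, [1], [8]), (94, 1, [3],
     [0, 9]), (72, 6, [], [7, 9]), (73, 0, [52], [7]), (77, 1, [], [0, 8]), (79, 0, [54], [2]),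
     (78, 2, [], [3, 55]), (75, 0, [2], [3]), (83, 0, [11], [1, 3]), (76, 2, [3], [1, 5]), (80,
     1, [], [2, 13]), (82, 0, [10], [2]), (81, 1, [2], [0, 3]), (84, 1, [], [2, 12]), (86, 1,
     [], [3, 4]), (85, 0, [1], [2]), (87, 14, [], [16, 18]), (90, 0, [1], [15]), (89, 1, [4],
     [0, 16]), (88, 1, [32], [2, 3]), (91, 0, [1, 5], [2, 33])]"

text \<open>In the equations of \<open>extend\<close> the recursive call stands under a lambda,
  where rewriting would unfold it for a symbolic candidate. Here candidates are consumed one by one,
  and \<open>extend_if\<close> hides the call until its condition has become \<open>True\<close> or
  \<open>False\<close>.\<close>

definition extend_all ::
  "('b \<Rightarrow> 'b list) \<Rightarrow> ('a \<times> nat \<times> nat list \<times> nat list) list \<Rightarrow> nat list \<Rightarrow> nat list \<Rightarrow>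
    'b list \<Rightarrow> 'b list \<Rightarrow> 'b list list" where
  "extend_all adj steps bs ds m xs =
     concat (map (\<lambda>x. if avoids x m ds \<and> joins adj x m bs
       then extend adj steps (x # m) else []) xs)"

definition extend_if ::
  "bool \<Rightarrow> ('b \<Rightarrow> 'b list) \<Rightarrow> ('a \<times> nat \<times> nat list \<times> nat list) list \<Rightarrow> 'b list \<Rightarrow> 'b list list" where
  "extend_if c adj steps m = (if c then extend adj steps m else [])"

lemma extend_rules:
  "extend adj [] m = [m]"
  "extend adj ((v, p, bs, ds) # steps) m = extend_all adj steps bs ds m (adj (m ! p))"
  "extend_all adj steps bs ds m [] = []"
  "extend_all adj steps bs ds m (x # xs) =
     extend_if (avoids x m ds \<and> joins adj x m bs)
       adj steps (x # m) @ extend_all adj steps bs ds m xs"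
  "extend_if True adj steps m = extend adj steps m"
  "extend_if False adj steps m = []"
  by (simp_all add: extend_all_def extend_if_def)

lemma nth_Cons_rules:
  "(x # xs) ! 0 = x"
  "(x # y # xs) ! 1 = y"
  "(x # xs) ! numeral n = xs ! pred_numeral n"
  by (simp_all add: numeral_eq_Suc)

lemma in_set_rules: "x \<in> set [] \<longleftrightarrow> False" "x \<in> set (y # ys) \<longleftrightarrow> x = y \<or> x \<in> set ys"
  by auto

lemmas eval_rules = avoids.simps joins.simps nth_Cons_rules pred_numeral_simps BitM.simps in_set_rules list.pred_inject
  append.simps numeral_eq_iff num.inject num.distinct zero_neq_numeral numeral_neq_zero
  zero_neq_one one_neq_zero one_eq_numeral_iff numeral_eq_one_iff simp_thms

lemma length_less:
  "0 < length (x # xs) \<longleftrightarrow> True" "1 < length (x # y # xs) \<longleftrightarrow> True"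
  "numeral n < length (x # xs) \<longleftrightarrow> pred_numeral n < length xs"
  by (simp_all add: numeral_eq_Suc)

lemma valid_plan: "valid_plan adj_H plan [2]"
  by (simp only: valid_plan.simps plan_def adj_H_simps eval_rules length_less)

definition plan_verts :: "nat list" where
  "plan_verts = rev (map fst plan) @ [2]"

lemma set_plan_verts: "set plan_verts = {..<112}"
proof (rule card_subset_eq)
  show "set plan_verts \<subseteq> {..<112}" by (simp add: plan_verts_def plan_def)
  have "distinct plan_verts" "length plan_verts = 112" by (simp_all add: plan_verts_def plan_def)
  then show "card (set plan_verts) = card {..<112::nat}" by (simp add: distinct_card)
qed simp

text \<open>The root 2 has no placed neighbour, so its image runs through all 112 vertices, with
  empty lists of tests; the plan takes over from there.\<close>

lemma graph_iso_in_extend_all: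
  assumes "is_graph_iso f graph_H K" "verts K = {..<112}"
    and edge: "\<And>u v. {u, v} \<in> edges K \<longleftrightarrow> v \<in> set (adj u)"
  shows "map f plan_verts \<in> set (extend_all adj plan [] [] [] [0..<112])"
proof -
  have f: "bij_betw f {..<112} {..<112}" using assms by (simp add: is_graph_iso_def verts_H)
  have "map f (rev (map fst plan) @ [2]) \<in> set (extend adj plan (map f [2]))"
  proof (rule embedding_in_extend [where V = "{..<112}", OF valid_plan])
    show "inj_on f {..<112}" using f by (simp add: bij_betw_def)
    show "fst ` set plan \<subseteq> {..<112}" using set_plan_verts by (auto simp: plan_verts_def)
    show "f v \<in> set (adj (f u))"
      if "u \<in> {..<112}" "v \<in> {..<112}" "v \<in> set (adj_H u)" for u v
      using that assms(1) by (simp add: is_graph_iso_def verts_H edge_H_iff edge)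
  qed simp
  moreover have "f 2 < 112" using f by (auto simp: bij_betw_def)
  ultimately show ?thesis
    by (auto simp: extend_all_def plan_verts_def)
qed

section \<open>The six automorphisms and the dihedral group\<close>

definition rot :: "nat \<Rightarrow> nat" where
  "rot v = (if v < 72 then v + 36 else if v < 108 then v - 72
     else if v = 108 then 108 else if v = 111 then 109 else v + 1)"

text \<open>The four-pole \<open>Q\<close> has an involution exchanging its semiedges 0 with 3 and 1
  with 2. Applied in all copies while the first two copies change places, it gives this reflection,
  which fixes the center and the leaf 109 and exchanges the leaves 110 and 111.\<close>

definition flip :: "nat \<Rightarrow> nat" where
  "flip v =
    [51, 54, 52, 48, 50, 53, 49, 55, 44, 45, 47, 46, 39, 42, 40, 36, 38, 41, 37, 43, 64, 69, 67,
     66, 68, 65, 71, 70, 56, 61, 59, 58, 60, 57, 63, 62, 15, 18, 16, 12, 14, 17, 13, 19, 8, 9,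
     11, 10, 3, 6, 4, 0, 2, 5, 1, 7, 28, 33, 31, 30, 32, 29, 35, 34, 20, 25, 23, 22, 24, 21, 27,
     26, 87, 90, 88, 84, 86, 89, 85, 91, 80, 81, 83, 82, 75, 78, 76, 72, 74, 77, 73, 79, 100,
     105, 103, 102, 104, 101, 107, 106, 92, 97, 95, 94, 96, 93, 99, 98, 108, 109, 111, 110] ! v"

lemma rot_table: "map rot [0..<112] =
    [36, 37, 38, 39, 40, 41, 42, 43, 44, 45, 46, 47, 48, 49, 50, 51, 52, 53, 54, 55, 56, 57, 58,
     59, 60, 61, 62, 63, 64, 65, 66, 67, 68, 69, 70, 71, 72, 73, 74, 75, 76, 77, 78, 79, 80, 81,
     82, 83, 84, 85, 86, 87, 88, 89, 90, 91, 92, 93, 94, 95, 96, 97, 98, 99, 100, 101, 102, 103,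
     104, 105, 106, 107, 0, 1, 2, 3, 4, 5, 6, 7, 8, 9, 10, 11, 12, 13, 14, 15, 16, 17, 18, 19,
     20, 21, 22, 23, 24, 25, 26, 27, 28, 29, 30, 31, 32, 33, 34, 35, 108, 110, 111, 109]"
  by (simp add: upt_112 rot_def)

lemma flip_table: "map flip [0..<112] =
    [51, 54, 52, 48, 50, 53, 49, 55, 44, 45, 47, 46, 39, 42, 40, 36, 38, 41, 37, 43, 64, 69, 67,
     66, 68, 65, 71, 70, 56, 61, 59, 58, 60, 57, 63, 62, 15, 18, 16, 12, 14, 17, 13, 19, 8, 9,
     11, 10, 3, 6, 4, 0, 2, 5, 1, 7, 28, 33, 31, 30, 32, 29, 35, 34, 20, 25, 23, 22, 24, 21, 27,
     26, 87, 90, 88, 84, 86, 89, 85, 91, 80, 81, 83, 82, 75, 78, 76, 72, 74, 77, 73, 79, 100,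
     105, 103, 102, 104, 101, 107, 106, 92, 97, 95, 94, 96, 93, 99, 98, 108, 109, 111, 110]"
  by (simp add: upt_112 flip_def)

lemmas rot_simps = rot_table [simplified upt_112 list.map list.inject simp_thms]
lemmas flip_simps = flip_table [simplified upt_112 list.map list.inject simp_thms]

definition aut :: "int \<times> bool \<Rightarrow> nat \<Rightarrow> nat" where
  "aut = (\<lambda>(k, s) v. (rot ^^ nat k) (if s then flip v else v))"

lemma aut_simps:
  "aut (0, False) v = v" "aut (1, False) v = rot v" "aut (2, False) v = rot (rot v)"
  "aut (0, True) v = flip v" "aut (1, True) v = rot (flip v)" "aut (2, True) v = rot (rot (flip v))"
  by (simp_all add: aut_def numeral_2_eq_2)

text \<open>The search tries the images of the vertex 2 in increasing order; the successful ones are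
  2, 16, 38, 52, 74, 88, which explains the order of the six group elements.\<close>

lemma embeddings_H:
  "extend_all adj_H plan [] [] [] [0..<112] =
     map (\<lambda>x. map (aut x) plan_verts) [(0, False), (2, True), (1, False), (0, True), (2, False), (1, True)]"
  by (simp only: extend_rules eval_rules plan_def adj_H_simps upt_112 plan_verts_def rev.simps
    list.map fst_conv aut_simps rot_simps flip_simps)

lemma embeddings_G: "extend_all adj_G plan [] [] [] [0..<112] = []"
  by (simp only: extend_rules eval_rules plan_def adj_G_simps upt_112)

lemma not_isomorphic_H_G: "\<not> isomorphic_graphs graph_H graph_G"
  using graph_iso_in_extend_all [OF _ verts_G edge_G_iff]
  by (auto simp: isomorphic_graphs_def embeddings_G)

lemma dihedral_carrier: "carrier (dihedral_group 3) = {0, 1, 2} \<times> UNIV"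
  by (auto simp: dihedral_group_def)

lemma dihedral_mult:
  "(a, s) \<otimes>\<^bsub>dihedral_group 3\<^esub> (b, t) = ((if s then a - b else a + b) mod 3, s \<noteq> t)"
  by (simp add: dihedral_group_def)

lemma graph_iso_H_cases:
  assumes "is_graph_iso f graph_H graph_H"
  shows "\<exists>x\<in>carrier (dihedral_group 3). \<forall>v<112. f v = aut x v"
proof -
  obtain x where "x \<in> carrier (dihedral_group 3)" "map f plan_verts = map (aut x) plan_verts"
    using graph_iso_in_extend_all [OF assms verts_H edge_H_iff]
    by (auto simp: embeddings_H dihedral_carrier)
  then show ?thesis by (auto simp: map_eq_conv set_plan_verts)
qed

lemma all_less_112: "(\<forall>v<112. P v) \<longleftrightarrow> list_all P [0..<112]"
  by (auto simp: list_all_iff)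

lemma rot_less: "v < 112 \<Longrightarrow> rot v < 112"
  by (auto simp: rot_def)

lemma flip_less: "v < 112 \<Longrightarrow> flip v < 112"
proof -
  have "list_all (\<lambda>x. x < 112) (map flip [0..<112])"
    unfolding flip_table by simp
  then show "v < 112 \<Longrightarrow> flip v < 112" by (simp add: list_all_iff)
qed

lemma rot_flip_relations:
  "\<forall>v<112. rot (rot (rot v)) = v \<and> flip (flip v) = v \<and> flip (rot v) = rot (rot (flip v))"
  by (simp only: all_less_112 upt_112 list.pred_inject rot_simps flip_simps simp_thms)

lemma rot_flip_adj:
  "\<forall>v<112. list_all (\<lambda>w. rot w \<in> set (adj_H (rot v)) \<and> flip w \<in> set (adj_H (flip v))) (adj_H v)"
  by (simp only: all_less_112 upt_112 eval_rules rot_simps flip_simps adj_H_simps)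

text \<open>Preservation of adjacency by the inverse \<open>g\<close> replaces its reflection by
  \<open>f\<close>, so only forward tests along the neighbour lists are required.\<close>

lemma H_iso_of_inverse:
  assumes "\<And>v. v < 112 \<Longrightarrow> f v < 112 \<and> g v < 112 \<and> f (g v) = v \<and> g (f v) = v"
    and "\<And>u v. u < 112 \<Longrightarrow> v \<in> set (adj_H u) \<Longrightarrow> f v \<in> set (adj_H (f u)) \<and> g v \<in> set (adj_H (g u))"
  shows "is_graph_iso f graph_H graph_H"
  unfolding is_graph_iso_def verts_H edge_H_iff
proof (intro conjI ballI)
  show "bij_betw f {..<112} {..<112}"
    using assms(1) by (intro bij_betwI [where g = g]) auto
  show "v \<in> set (adj_H u) \<longleftrightarrow> f v \<in> set (adj_H (f u))" if "u \<in> {..<112}" "v \<in> {..<112}" for u v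
    using that assms(1) [of u] assms(1) [of v] assms(2) [of u v] assms(2) [of "f u" "f v"] by auto
qed

lemma graph_iso_comp:
  assumes "is_graph_iso g A B" "is_graph_iso f B C"
  shows "is_graph_iso (f \<circ> g) A C"
  unfolding is_graph_iso_def
proof (intro conjI ballI)
  show "bij_betw (f \<circ> g) (verts A) (verts C)"
    using assms by (auto simp: is_graph_iso_def intro: bij_betw_trans)
  fix u v assume uv: "u \<in> verts A" "v \<in> verts A"
  then have "g u \<in> verts B" "g v \<in> verts B"
    using assms(1) by (auto simp: is_graph_iso_def bij_betw_def)
  then show "{u, v} \<in> edges A \<longleftrightarrow> {(f \<circ> g) u, (f \<circ> g) v} \<in> edges C"
    using assms uv by (simp add: is_graph_iso_def)
qed

lemma is_graph_iso_rot: "is_graph_iso rot graph_H graph_H"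
proof (rule H_iso_of_inverse [where g = "\<lambda>v. rot (rot v)"])
  fix u v :: nat assume uv: "u < 112" "v \<in> set (adj_H u)"
  have step: "rot b \<in> set (adj_H (rot a))" if "a < 112" "b \<in> set (adj_H a)" for a b
    using rot_flip_adj that by (auto simp: list_all_iff)
  show "rot v \<in> set (adj_H (rot u)) \<and> rot (rot v) \<in> set (adj_H (rot (rot u)))"
    using uv step rot_less by blast
qed (use rot_less rot_flip_relations in auto)

lemma is_graph_iso_flip: "is_graph_iso flip graph_H graph_H"
  using flip_less rot_flip_relations rot_flip_adj
  by (intro H_iso_of_inverse [where g = flip]) (auto simp: list_all_iff)

lemma is_graph_iso_aut:
  assumes "x \<in> carrier (dihedral_group 3)"
  shows "is_graph_iso (aut x) graph_H graph_H"
proof -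
  have "is_graph_iso (rot ^^ n) graph_H graph_H" for n
  proof (induction n)
    case (Suc n)
    show ?case using graph_iso_comp [OF Suc.IH is_graph_iso_rot] by (simp only: funpow.simps)
  qed (simp add: is_graph_iso_def id_def bij_betw_def)
  moreover obtain k s where "x = (k, s)" by (cases x)
  moreover have "aut (k, s) = (if s then (rot ^^ nat k) \<circ> flip else rot ^^ nat k)"
    by (auto simp: aut_def fun_eq_iff)
  ultimately show ?thesis
    using graph_iso_comp [OF is_graph_iso_flip] by auto
qed

lemma aut_less:
  assumes "x \<in> carrier (dihedral_group 3)" "v < 112"
  shows "aut x v < 112"
  using is_graph_iso_aut [OF assms(1)] assms(2) by (auto simp: is_graph_iso_def verts_H bij_betw_def)

lemma aut_mult:
  assumes "x \<in> carrier (dihedral_group 3)" "y \<in> carrier (dihedral_group 3)" "v < 112"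
  shows "aut (x \<otimes>\<^bsub>dihedral_group 3\<^esub> y) v = aut x (aut y v)"
proof -
  have "rot (rot (rot u)) = u" "flip (flip u) = u" "flip (rot u) = rot (rot (flip u))" if "u < 112" for u
    using rot_flip_relations that by auto
  moreover obtain k s l t where "x = (k, s)" "y = (l, t)" by (cases x, cases y)
  ultimately show ?thesis
    using assms rot_less flip_less
    by (cases s; cases t) (auto simp: dihedral_carrier dihedral_mult aut_simps)
qed

text \<open>The vertex 0 has the six different images 0, 36, 72, 51, 87, 15, so its image alone
  determines the group element.\<close>

lemma aut_inj:
  assumes "x \<in> carrier (dihedral_group 3)" "y \<in> carrier (dihedral_group 3)" "aut x 0 = aut y 0"
  shows "x = y"
proof -
  have "rot 0 = 36" "rot 36 = 72" "flip 0 = 51" "rot 51 = 87" "rot 87 = 15"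
    by (simp_all add: rot_def flip_def)
  moreover obtain k s l t where "x = (k, s)" "y = (l, t)" by (cases x, cases y)
  ultimately show ?thesis
    using assms by (cases s; cases t) (auto simp: dihedral_carrier aut_simps)
qed

text \<open>The members of \<open>Bij\<close> are extensional, whence \<open>restrict\<close>. The
  homomorphism property comes from the relations between \<open>rot\<close> and \<open>flip\<close>,
  injectivity from the vertex 0, and surjectivity from the exhaustive search.\<close>

lemma aut_iso_automorphism_group:
  "(\<lambda>x. restrict (aut x) {..<112}) \<in> iso (dihedral_group 3) (automorphism_group graph_H)"
proof (rule isoI)
  let ?h = "\<lambda>x. restrict (aut x) {..<112::nat}"
  have iso_restrict: "is_graph_iso (?h x) graph_H graph_H" if "x \<in> carrier (dihedral_group 3)" for x
    using is_graph_iso_aut [OF that] unfolding is_graph_iso_def verts_H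
    by (auto simp: bij_betw_def inj_on_def image_restrict_eq)
  have h_carrier: "?h x \<in> carrier (automorphism_group graph_H)"
    if "x \<in> carrier (dihedral_group 3)" for x
    using iso_restrict [OF that]
    by (auto simp: automorphism_group_def Bij_def verts_H is_graph_iso_def)
  show "?h \<in> hom (dihedral_group 3) (automorphism_group graph_H)"
  proof (rule homI)
    fix x y assume xy: "x \<in> carrier (dihedral_group 3)" "y \<in> carrier (dihedral_group 3)"
    have "?h (x \<otimes>\<^bsub>dihedral_group 3\<^esub> y) = compose {..<112} (?h x) (?h y)"
      using xy aut_less by (auto simp: fun_eq_iff compose_def aut_mult)
    then show "?h (x \<otimes>\<^bsub>dihedral_group 3\<^esub> y) = ?h x \<otimes>\<^bsub>automorphism_group graph_H\<^esub> ?h y"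
      using h_carrier [OF xy(1)] h_carrier [OF xy(2)]
      by (simp add: automorphism_group_def BijGroup_def verts_H)
  qed (rule h_carrier)
  show "bij_betw ?h (carrier (dihedral_group 3)) (carrier (automorphism_group graph_H))"
  proof (rule bij_betwI')
    fix x y assume "x \<in> carrier (dihedral_group 3)" "y \<in> carrier (dihedral_group 3)"
    then show "(?h x = ?h y) = (x = y)"
      using aut_inj by (metis lessThan_iff restrict_apply' zero_less_numeral)
  next
    fix f assume "f \<in> carrier (automorphism_group graph_H)"
    then have f: "is_graph_iso f graph_H graph_H" "f \<in> extensional {..<112}"
      by (auto simp: automorphism_group_def Bij_def verts_H)
    obtain x where "x \<in> carrier (dihedral_group 3)" "\<forall>v<112. f v = aut x v"
      using graph_iso_H_cases [OF f(1)] by blast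
    moreover from this(2) have "f = ?h x"
      using f(2) by (auto simp: fun_eq_iff extensional_def)
    ultimately show "\<exists>x\<in>carrier (dihedral_group 3). f = ?h x" by blast
  qed (rule h_carrier)
qed

lemma automorphism_group_H: "automorphism_group graph_H \<cong> dihedral_group 3"
  using aut_iso_automorphism_group group.iso_sym [OF group_dihedral_group [of 3]]
  by (auto simp: is_iso_def)

lemma order_automorphism_group_H: "order (automorphism_group graph_H) = 6"
proof -
  have "card (carrier (automorphism_group graph_H)) = card (carrier (dihedral_group 3))"
    using aut_iso_automorphism_group by (auto simp: iso_def dest: bij_betw_same_card)
  then show ?thesis by (simp add: order_def dihedral_carrier card_cartesian_product)
qed

section \<open>Girth and connectivity\<close>

lemma adj_H_checks:
  "list_all (\<lambda>v. list_all (\<lambda>w. w < 112 \<and> w \<noteq> v) (adj_H v) \<and> distinct (adj_H v) \<and> length (adj_H v) = 3)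
     [0..<112]"
  \<comment> \<open>\<open>One_nat_def\<close> would turn the vertex 1 into \<open>Suc 0\<close>,
    which no rule of the table matches.\<close>
  unfolding upt_112 by (simp add: adj_H_simps del: One_nat_def)

lemma adj_H_props:
  assumes "v < 112"
  shows "w \<in> set (adj_H v) \<Longrightarrow> w < 112 \<and> w \<noteq> v" "card (set (adj_H v)) = 3"
  using adj_H_checks assms by (auto simp: list_all_iff distinct_card)

lemma edges_HE:
  assumes "e \<in> edges graph_H"
  obtains u v where "e = {u, v}" "u < 112" "v \<in> set (adj_H u)"
proof -
  have "list_all (\<lambda>(u, v). u < 112) H_pairs" by (simp add: H_pairs_eval)
  moreover obtain u v where "(u, v) \<in> set H_pairs" "e = {u, v}"
    using assms by (auto simp: edges_H_pairs)
  ultimately show ?thesis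
    using that assms by (auto simp: list_all_iff edge_H_iff)
qed

lemma simple_graph_H: "simple_graph graph_H"
  unfolding simple_graph_def verts_H
  by (auto elim!: edges_HE dest: adj_H_props(1))

lemma incident_H: "incident graph_H v = (\<lambda>w. {v, w}) ` set (adj_H v)"
proof
  show "incident graph_H v \<subseteq> (\<lambda>w. {v, w}) ` set (adj_H v)"
  proof
    fix e assume e: "e \<in> incident graph_H v"
    then obtain a b where "e = {a, b}" by (auto simp: incident_def elim: edges_HE)
    with e obtain w where "e = {v, w}" by (auto simp: incident_def)
    with e show "e \<in> (\<lambda>w. {v, w}) ` set (adj_H v)" by (auto simp: incident_def edge_H_iff)
  qed
qed (auto simp: incident_def edge_H_iff)

lemma card_incident_H: "v < 112 \<Longrightarrow> card (incident graph_H v) = 3"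
  by (simp add: incident_H card_image inj_on_def doubleton_eq_iff adj_H_props)

lemma cubic_H: "cubic graph_H"
  by (simp add: cubic_def verts_H card_incident_H)

lemma finite_edges_H: "finite (edges graph_H)"
  by (simp add: edges_H_pairs)

text \<open>Counting incidences twice gives 3 * 112 = 2 * 168 without comparing the edges with each
  other.\<close>

lemma card_edges_H: "card (edges graph_H) = 168"
proof -
  have "card {v \<in> {..<112}. v \<in> e} = 2" if "e \<in> edges graph_H" for e
  proof -
    have "e \<subseteq> {..<112}" "card e = 2" using simple_graph_H that by (auto simp: simple_graph_def verts_H)
    moreover from this have "{v \<in> {..<112}. v \<in> e} = e" by auto
    ultimately show ?thesis by simp
  qed
  then have "(\<Sum>v<112. card {e \<in> edges graph_H. v \<in> e}) = 2 * card (edges graph_H)"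
    using finite_edges_H by (intro sum_multicount) auto
  then show ?thesis using card_incident_H by (simp add: incident_def)
qed

text \<open>The list has as many entries as there are edges, so no join produces a parallel
  edge.\<close>

lemma distinct_H_edge_list: "distinct H_edge_list"
proof (rule card_distinct)
  have "length H_edge_list = 168" by (simp add: H_edge_list_pairs H_pairs_eval)
  then show "card (set H_edge_list) = length H_edge_list"
    using card_edges_H by (simp add: graph_H_def)
qed

text \<open>For a walk \<open>a\<close>, \<open>b\<close>, \<open>c\<close> without reversal, an
  edge from \<open>c\<close> to \<open>a\<close> would close a triangle, and an edge from some
  \<open>d\<close> other than \<open>b\<close> would close a quadrilateral.\<close>

lemma no_short_closed_walks:
  "list_all (\<lambda>a. list_all (\<lambda>b. list_all (\<lambda>c. a = c \<or> a \<notin> set (adj_H c) \<and>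
     list_all (\<lambda>d. b = d \<or> a \<notin> set (adj_H d)) (adj_H c)) (adj_H b)) (adj_H a)) [0..<112]"
  unfolding upt_112
  by (simp only: eval_rules adj_H_simps)

lemma is_cycle_3: "is_cycle G [a, b, c] \<longleftrightarrow> distinct [a, b, c] \<and> {a, b, c} \<subseteq> verts G \<and>
    {a, b} \<in> edges G \<and> {b, c} \<in> edges G \<and> {c, a} \<in> edges G"
  by (auto simp: is_cycle_def All_less_Suc)

lemma is_cycle_4: "is_cycle G [a, b, c, d] \<longleftrightarrow> distinct [a, b, c, d] \<and> {a, b, c, d} \<subseteq> verts G \<and>
    {a, b} \<in> edges G \<and> {b, c} \<in> edges G \<and> {c, d} \<in> edges G \<and> {d, a} \<in> edges G"
  by (auto simp: is_cycle_def All_less_Suc)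

lemma is_cycle_5: "is_cycle G [a, b, c, d, e] \<longleftrightarrow> distinct [a, b, c, d, e] \<and>
    {a, b, c, d, e} \<subseteq> verts G \<and>
    {a, b} \<in> edges G \<and> {b, c} \<in> edges G \<and> {c, d} \<in> edges G \<and> {d, e} \<in> edges G \<and> {e, a} \<in> edges G"
  by (auto simp: is_cycle_def All_less_Suc)

lemma girth_H: "girth graph_H = 5"
proof (rule antisym)
  have "is_cycle graph_H [0, 1, 6, 3, 5]"
    unfolding is_cycle_5 verts_H edge_H_iff by (simp add: adj_H_simps del: One_nat_def)
  then have "girth graph_H \<le> enat (length [0, 1, 6, 3, 5 :: nat])"
    unfolding girth_def by (intro INF_lower) simp
  then show "girth graph_H \<le> 5" by (simp add: numeral_eq_enat eval_nat_numeral)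
  show "5 \<le> girth graph_H"
    unfolding girth_def
  proof (rule INF_greatest)
    fix vs assume "vs \<in> {vs. is_cycle graph_H vs}"
    then have cyc: "is_cycle graph_H vs" by simp
    have False if "length vs < 5"
    proof -
      have short: "b \<in> set (adj_H a) \<Longrightarrow> c \<in> set (adj_H b) \<Longrightarrow> a \<noteq> c \<Longrightarrow>
          a \<notin> set (adj_H c) \<and> (\<forall>d\<in>set (adj_H c). b = d \<or> a \<notin> set (adj_H d))" if "a < 112" for a b c
        using no_short_closed_walks that
        unfolding list_all_iff by (metis atLeastLessThan_iff set_upt zero_le)
      have "length vs = 3 \<or> length vs = 4" using that cyc by (auto simp: is_cycle_def)
      then show False
      proof
        assume "length vs = 3"
        then obtain a b c where "vs = [a, b, c]" by (auto simp: length_Suc_conv numeral_eq_Suc)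
        then show False
          using cyc short [of a b c]
          by (auto simp: is_cycle_3 verts_H edge_H_iff)
      next
        assume "length vs = 4"
        then obtain a b c d where "vs = [a, b, c, d]" by (auto simp: length_Suc_conv numeral_eq_Suc)
        then show False
          using cyc short [of a b c]
          by (auto simp: is_cycle_4 verts_H edge_H_iff)
      qed
    qed
    then show "5 \<le> enat (length vs)" by (force simp: numeral_eq_enat)
  qed
qed

section \<open>Disjoint walks and connectivity\<close>

fun path_edges :: "'a list \<Rightarrow> 'a set set" where
  "path_edges (x # y # xs) = insert {x, y} (path_edges (y # xs))"
| "path_edges _ = {}"

fun walk :: "('a \<Rightarrow> 'a list) \<Rightarrow> 'a list \<Rightarrow> bool" where
  "walk adj (x # y # xs) \<longleftrightarrow> y \<in> set (adj x) \<and> walk adj (y # xs)"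
| "walk adj [x] \<longleftrightarrow> True"
| "walk adj [] \<longleftrightarrow> True"

lemma walk_path_edges: "walk adj_H xs \<Longrightarrow> path_edges xs \<subseteq> edges graph_H"
  by (induction xs rule: path_edges.induct) (auto simp: edge_H_iff)

lemma walk_last_less: "walk adj_H (u # us) \<Longrightarrow> u < 112 \<Longrightarrow> last (u # us) < 112"
  by (induction us arbitrary: u) (auto dest: adj_H_props(1))

lemma path_edges_subset: "e \<in> path_edges xs \<Longrightarrow> e \<subseteq> set xs"
  by (induction xs rule: path_edges.induct) auto

text \<open>The first vertex and the end in \<open>ts\<close> are never consecutive, because
  \<open>ws\<close> is nonempty; hence every edge contains a vertex of \<open>ws\<close>. Walks with
  disjoint lists \<open>ws\<close> are therefore also edge-disjoint, and one notion of fan serves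
  both kinds of deletion.\<close>

lemma path_edges_meet:
  "e \<in> path_edges (v # ws @ ts) \<Longrightarrow> ws \<noteq> [] \<Longrightarrow> length ts \<le> 1 \<Longrightarrow> e \<inter> set ws \<noteq> {}"
proof (induction ws arbitrary: v)
  case (Cons w ws)
  show ?case
  proof (cases "ws = []")
    case True
    with Cons.prems show ?thesis by (cases ts) auto
  next
    case False
    with Cons show ?thesis by (cases "e = {v, w}") auto
  qed
qed simp

lemma reachable_refl: "reachable G v v"
  by (simp add: reachable_def)

lemma reachable_trans: "reachable G u v \<Longrightarrow> reachable G v w \<Longrightarrow> reachable G u w"
  unfolding reachable_def by (rule rtrancl_trans)

lemma reachable_sym: "reachable G u v \<Longrightarrow> reachable G v u"
proof -
  have "sym {(x, y). {x, y} \<in> edges G}" by (auto simp: sym_def insert_commute)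
  then show "reachable G u v \<Longrightarrow> reachable G v u"
    unfolding reachable_def by (meson sym_rtrancl symD)
qed

lemma reachable_path: "path_edges (x # xs) \<subseteq> edges G \<Longrightarrow> reachable G x (last (x # xs))"
proof (induction xs arbitrary: x)
  case (Cons y xs)
  then have "{x, y} \<in> edges G" "reachable G y (last (y # xs))" by auto
  then have "reachable G x y" by (auto simp: reachable_def)
  with \<open>reachable G y (last (y # xs))\<close> show ?case by (auto intro: reachable_trans)
qed (simp add: reachable_refl)

lemma small_set_misses:
  assumes "finite S" "card S < 3" "A \<inter> B = {}" "A \<inter> C = {}" "B \<inter> C = {}"
  shows "A \<inter> S = {} \<or> B \<inter> S = {} \<or> C \<inter> S = {}"
proof (rule ccontr)
  assume "\<not> ?thesis"
  then obtain a b c where abc: "a \<in> A \<inter> S" "b \<in> B \<inter> S" "c \<in> C \<inter> S" by blast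
  with assms have "card {a, b, c} = 3" by (auto simp: card_insert_if)
  moreover have "card {a, b, c} \<le> card S" using abc assms(1) by (intro card_mono) auto
  ultimately show False using assms(2) by simp
qed

text \<open>The list \<open>ts\<close> contains the common end vertex of the three walks, if there is one.\<close>

definition fan :: "nat \<Rightarrow> nat list \<Rightarrow> nat list list \<Rightarrow> bool" where
  "fan v ts wss \<longleftrightarrow> length wss = 3 \<and> length ts \<le> 1 \<and> distinct (v # ts @ concat wss) \<and>
     list_all (\<lambda>ws. ws \<noteq> [] \<and> walk adj_H (v # ws @ ts)) wss"

text \<open>If \<open>ts\<close> is empty, the end of the walk belongs to \<open>ws\<close>; the
  second conjunct then says that this end survives the deletion.\<close>

lemma fan_vertex_deletion:
  assumes "fan v ts wss" "finite S" "card S < 3" "v \<notin> S" "set ts \<inter> S = {}"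
  shows "\<exists>ws\<in>set wss. reachable (delete_verts graph_H S) v (last (v # ws @ ts)) \<and> set ws \<inter> S = {}"
proof -
  obtain xs ys zs where wss: "wss = [xs, ys, zs]"
    using assms(1) by (auto simp: fan_def length_Suc_conv numeral_eq_Suc)
  have "\<exists>ws\<in>set wss. set ws \<inter> S = {}"
    using small_set_misses [of S "set xs" "set ys" "set zs"] assms by (auto simp: fan_def wss)
  then obtain ws where ws: "ws \<in> set wss" "set ws \<inter> S = {}" ..
  then have "path_edges (v # ws @ ts) \<subseteq> edges graph_H"
    using assms(1) by (intro walk_path_edges) (auto simp: fan_def list_all_iff)
  moreover have "e \<inter> S = {}" if "e \<in> path_edges (v # ws @ ts)" for e
    using path_edges_subset [OF that] ws assms by auto
  ultimately have "path_edges (v # ws @ ts) \<subseteq> edges (delete_verts graph_H S)"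
    by (auto simp: delete_verts_def)
  then show ?thesis using ws reachable_path [of v "ws @ ts"] by blast
qed

lemma fan_edge_deletion:
  assumes "fan v ts wss" "finite F" "card F < 3"
  shows "\<exists>ws\<in>set wss. reachable (delete_edges graph_H F) v (last (v # ws @ ts))"
proof -
  obtain xs ys zs where wss: "wss = [xs, ys, zs]"
    using assms(1) by (auto simp: fan_def length_Suc_conv numeral_eq_Suc)
  let ?E = "\<lambda>ws. path_edges (v # ws @ ts)"
  have disj: "?E ws \<inter> ?E ws' = {}"
    if "set ws \<inter> set ws' = {}" "ws \<in> set wss" "ws' \<in> set wss" for ws ws'
  proof -
    have "False" if "e \<in> ?E ws" "e \<in> ?E ws'" for e
    proof -
      have "e \<inter> set ws \<noteq> {}"
        using that assms(1) \<open>ws \<in> set wss\<close> by (intro path_edges_meet) (auto simp: fan_def list_all_iff)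
      moreover have "e \<subseteq> set (v # ws' @ ts)" using that path_edges_subset by blast
      moreover have "set ws \<inter> set (v # ts) = {}"
        using assms(1) \<open>ws \<in> set wss\<close> by (auto simp: fan_def)
      ultimately show False using \<open>set ws \<inter> set ws' = {}\<close> by auto
    qed
    then show ?thesis by blast
  qed
  have "set xs \<inter> set ys = {}" "set xs \<inter> set zs = {}" "set ys \<inter> set zs = {}"
    using assms(1) by (auto simp: fan_def wss)
  then have "\<exists>ws\<in>set wss. ?E ws \<inter> F = {}"
    using small_set_misses [of F "?E xs" "?E ys" "?E zs"] assms disj by (simp add: wss)
  then obtain ws where ws: "ws \<in> set wss" "?E ws \<inter> F = {}" ..
  then have "?E ws \<subseteq> edges graph_H"
    using assms(1) by (intro walk_path_edges) (auto simp: fan_def list_all_iff)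
  with ws have "?E ws \<subseteq> edges (delete_edges graph_H F)" by (auto simp: delete_edges_def)
  then show ?thesis using ws reachable_path [of v "ws @ ts"] by blast
qed

text \<open>The first copy of \<open>Q\<close> is joined to the leaf 109 at its vertex 24 and to the
  leaf 111 at its vertex 32. The walk to the leaf 110 has to cross another copy: the second one,
  entered at 52, or the third one, entered at 74.\<close>

definition Q_fans :: "(nat \<times> nat list \<times> nat list \<times> nat list) list" where
  "Q_fans =
    [(0, [1, 2, 52, 54, 51, 58, 63, 60, 110], [5, 3, 11, 8, 10, 20, 21, 26, 24, 109], [31, 34,
     32, 111]), (1, [0, 31, 34, 32, 111], [2, 52, 54, 51, 58, 63, 60, 110], [6, 3, 11, 8, 10,
     20, 21, 26, 24, 109]), (2, [1, 0, 31, 34, 32, 111], [7, 4, 9, 8, 10, 20, 21, 26, 24, 109],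
     [52, 54, 51, 58, 63, 60, 110]), (3, [5, 0, 31, 34, 32, 111], [6, 1, 2, 52, 54, 51, 58, 63,
     60, 110], [11, 8, 10, 20, 21, 26, 24, 109]), (4, [6, 1, 0, 31, 34, 32, 111], [7, 2, 52, 54,
     51, 58, 63, 60, 110], [9, 8, 10, 20, 21, 26, 24, 109]), (5, [0, 31, 34, 32, 111], [3, 11,
     8, 10, 20, 21, 26, 24, 109], [7, 2, 52, 54, 51, 58, 63, 60, 110]), (6, [1, 0, 31, 34, 32,
     111], [3, 11, 8, 10, 20, 21, 26, 24, 109], [4, 7, 2, 52, 54, 51, 58, 63, 60, 110]), (7, [2,
     52, 54, 51, 58, 63, 60, 110], [4, 9, 8, 10, 20, 21, 26, 24, 109], [5, 0, 31, 34, 32, 111]),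
     (8, [9, 4, 7, 2, 52, 54, 51, 58, 63, 60, 110], [10, 20, 21, 26, 24, 109], [11, 28, 29, 34,
     32, 111]), (9, [4, 6, 1, 0, 31, 34, 32, 111], [8, 10, 20, 21, 26, 24, 109], [14, 19, 16,
     74, 73, 72, 103, 106, 104, 110]), (10, [8, 11, 28, 29, 34, 32, 111], [12, 13, 18, 16, 74,
     73, 72, 103, 106, 104, 110], [20, 21, 26, 24, 109]), (11, [3, 5, 7, 2, 52, 54, 51, 58, 63,
     60, 110], [8, 10, 20, 21, 26, 24, 109], [28, 29, 34, 32, 111]), (12, [10, 8, 11, 28, 29,
     34, 32, 111], [13, 18, 16, 74, 73, 72, 103, 106, 104, 110], [17, 15, 22, 27, 24, 109]),
     (13, [12, 10, 8, 11, 28, 29, 34, 32, 111], [14, 19, 16, 74, 73, 72, 103, 106, 104, 110],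
     [18, 15, 22, 27, 24, 109]), (14, [9, 8, 11, 28, 29, 34, 32, 111], [13, 18, 15, 22, 27, 24,
     109], [19, 16, 74, 73, 72, 103, 106, 104, 110]), (15, [17, 12, 10, 8, 11, 28, 29, 34, 32,
     111], [18, 16, 74, 73, 72, 103, 106, 104, 110], [22, 27, 24, 109]), (16, [18, 15, 22, 27,
     24, 109], [19, 14, 9, 8, 11, 28, 29, 34, 32, 111], [74, 73, 72, 103, 106, 104, 110]), (17,
     [12, 10, 8, 11, 28, 29, 34, 32, 111], [15, 22, 27, 24, 109], [19, 16, 74, 73, 72, 103, 106,
     104, 110]), (18, [13, 12, 10, 8, 11, 28, 29, 34, 32, 111], [15, 22, 27, 24, 109], [16, 74,
     73, 72, 103, 106, 104, 110]), (19, [14, 9, 8, 11, 28, 29, 34, 32, 111], [16, 74, 73, 72,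
     103, 106, 104, 110], [17, 15, 22, 27, 24, 109]), (20, [10, 12, 13, 18, 16, 74, 73, 72, 103,
     106, 104, 110], [21, 26, 24, 109], [25, 23, 30, 35, 32, 111]), (21, [20, 25, 23, 30, 35,
     32, 111], [22, 15, 18, 16, 74, 73, 72, 103, 106, 104, 110], [26, 24, 109]), (22, [15, 18,
     16, 74, 73, 72, 103, 106, 104, 110], [21, 26, 23, 30, 35, 32, 111], [27, 24, 109]), (23,
     [25, 27, 22, 15, 18, 16, 74, 73, 72, 103, 106, 104, 110], [26, 24, 109], [30, 35, 32,
     111]), (24, [26, 23, 30, 35, 32, 111], [27, 22, 15, 18, 16, 74, 73, 72, 103, 106, 104,
     110], [109]), (25, [20, 10, 12, 13, 18, 16, 74, 73, 72, 103, 106, 104, 110], [23, 30, 35,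
     32, 111], [27, 24, 109]), (26, [21, 22, 15, 18, 16, 74, 73, 72, 103, 106, 104, 110], [23,
     30, 35, 32, 111], [24, 109]), (27, [22, 15, 18, 16, 74, 73, 72, 103, 106, 104, 110], [24,
     109], [25, 23, 30, 35, 32, 111]), (28, [11, 3, 5, 7, 2, 52, 54, 51, 58, 63, 60, 110], [29,
     30, 23, 26, 24, 109], [33, 35, 32, 111]), (29, [28, 11, 3, 5, 7, 2, 52, 54, 51, 58, 63, 60,
     110], [30, 23, 26, 24, 109], [34, 32, 111]), (30, [23, 26, 24, 109], [29, 34, 31, 0, 1, 2,
     52, 54, 51, 58, 63, 60, 110], [35, 32, 111]), (31, [0, 1, 2, 52, 54, 51, 58, 63, 60, 110],
     [33, 35, 30, 23, 26, 24, 109], [34, 32, 111]), (32, [34, 31, 0, 1, 2, 52, 54, 51, 58, 63,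
     60, 110], [35, 30, 23, 26, 24, 109], [111]), (33, [28, 29, 30, 23, 26, 24, 109], [31, 0, 1,
     2, 52, 54, 51, 58, 63, 60, 110], [35, 32, 111]), (34, [29, 30, 23, 26, 24, 109], [31, 0, 1,
     2, 52, 54, 51, 58, 63, 60, 110], [32, 111]), (35, [30, 23, 26, 24, 109], [32, 111], [33,
     31, 0, 1, 2, 52, 54, 51, 58, 63, 60, 110])]"

fun fan_at :: "(nat \<Rightarrow> nat) \<Rightarrow> nat list \<Rightarrow> nat \<times> nat list \<times> nat list \<times> nat list \<Rightarrow> bool" where
  "fan_at f ts (v, xs, ys, zs) \<longleftrightarrow> fan (f v) (map f ts) [map f xs, map f ys, map f zs] \<and>
     (ts = [] \<longrightarrow> list_all (\<lambda>w. w = 109 \<or> w = 110 \<or> w = 111) [last (map f xs), last (map f ys), last (map f zs)])"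

lemma list_length_rules: "length ([] :: 'a list) \<le> 1" "length [x] \<le> 1" "length [x, y, z] = 3"
  by simp_all

lemmas fan_eval = fan_def fan_at.simps walk.simps list_length_rules eval_rules adj_H_simps distinct.simps
  concat.simps list.map rot_simps list.distinct last.simps if_True if_False

lemma Q_fans_0: "list_all (fan_at (\<lambda>v. v) []) Q_fans"
  unfolding Q_fans_def by (simp only: fan_eval)

lemma Q_fans_1: "list_all (fan_at rot []) Q_fans"
  unfolding Q_fans_def by (simp only: fan_eval)

lemma Q_fans_2: "list_all (fan_at (\<lambda>v. rot (rot v)) []) Q_fans"
  unfolding Q_fans_def by (simp only: fan_eval)

text \<open>From 109 to 110 one walk goes through the first and third copies of \<open>Q\<close>,
  one through the second copy, and one through the center. Rotations give the other two pairs of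
  leaves.\<close>

definition leaf_fan :: "nat \<times> nat list \<times> nat list \<times> nat list" where
  "leaf_fan = (109, [24, 27, 22, 15, 18, 16, 74, 73, 72, 103, 106, 104], [68, 71, 66, 59, 62, 60], [108])"

lemma leaf_fans:
  "fan_at (\<lambda>v. v) [110] leaf_fan" "fan_at rot [110] leaf_fan" "fan_at (\<lambda>v. rot (rot v)) [110] leaf_fan"
  unfolding leaf_fan_def by (simp_all only: fan_eval)

lemma map_fst_Q_fans: "map fst Q_fans = [0..<36]"
  by (simp add: Q_fans_def upt_rec)

lemma fan_to_leaves:
  assumes "v < 109"
  shows "\<exists>wss. fan v [] wss \<and> (\<forall>ws\<in>set wss. last (v # ws) \<in> {109, 110, 111})"
proof (cases "v = 108")
  case True
  have "fan 108 [] [[109], [110], [111]]" by (simp only: fan_eval)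
  then show ?thesis using True by (intro exI [of _ "[[109], [110], [111]]"]) auto
next
  case False
  have "\<exists>f\<in>{\<lambda>v. v, rot, \<lambda>v. rot (rot v)}. f (v mod 36) = v"
  proof -
    have "v < 36 \<or> 36 \<le> v \<and> v < 72 \<or> 72 \<le> v \<and> v < 108" using assms False by auto
    then show ?thesis
    proof (elim disjE)
      assume "36 \<le> v \<and> v < 72"
      then obtain u where u: "v = u + 1 * 36" "u < 36" by (auto simp: le_iff_add)
      then have "v mod 36 = u" by (simp only: mod_mult_self1) simp
      then show ?thesis using u by (auto simp: rot_def)
    next
      assume "72 \<le> v \<and> v < 108"
      then obtain u where u: "v = u + 2 * 36" "u < 36" by (auto simp: le_iff_add)
      then have "v mod 36 = u" by (simp only: mod_mult_self1) simp
      then show ?thesis using u by (auto simp: rot_def)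
    qed auto
  qed
  then obtain f where f: "f \<in> {\<lambda>v. v, rot, \<lambda>v. rot (rot v)}" "f (v mod 36) = v" by blast
  have "v mod 36 \<in> set (map fst Q_fans)" unfolding map_fst_Q_fans by simp
  then obtain xs ys zs where Q: "(v mod 36, xs, ys, zs) \<in> set Q_fans" by auto
  have "list_all (fan_at f []) Q_fans" using f(1) Q_fans_0 Q_fans_1 Q_fans_2 by auto
  then have "fan_at f [] (v mod 36, xs, ys, zs)" using Q by (auto simp: list_all_iff)
  then show ?thesis
    using f(2) by (intro exI [of _ "[map f xs, map f ys, map f zs]"]) (auto simp: fan_def)
qed

lemma fan_between_leaves:
  assumes "l \<in> {109, 110, 111}" "m \<in> {109, 110, 111}" "l \<noteq> m"
  shows "(\<exists>wss. fan l [m] wss) \<or> (\<exists>wss. fan m [l] wss)"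
proof -
  have "\<exists>wss. fan 109 [110] wss" "\<exists>wss. fan 110 [111] wss" "\<exists>wss. fan 111 [109] wss"
    using leaf_fans by (auto simp: leaf_fan_def rot_def)
  then show ?thesis using assms by auto
qed

text \<open>The common core of both deletion results: if every fan with surviving prescribed ends
  keeps one walk, each vertex reaches a surviving leaf, and the surviving leaves reach each
  other.\<close>

lemma connected_by_fans:
  assumes "verts K \<subseteq> {..<112}" "verts K \<noteq> {}"
    and fans: "\<And>v ts wss. fan v ts wss \<Longrightarrow> insert v (set ts) \<subseteq> verts K \<Longrightarrow>
      \<exists>ws\<in>set wss. reachable K v (last (v # ws @ ts)) \<and> last (v # ws @ ts) \<in> verts K"
  shows "connected_graph K"
proof -
  let ?L = "{109, 110, 111 :: nat}"
  have to_leaf: "\<exists>l\<in>?L \<inter> verts K. reachable K v l" if v: "v \<in> verts K" for v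
  proof (cases "v < 109")
    case True
    then obtain wss where wss: "fan v [] wss" "\<forall>ws\<in>set wss. last (v # ws) \<in> ?L"
      using fan_to_leaves by blast
    from fans [OF wss(1)] v obtain ws where "ws \<in> set wss" "reachable K v (last (v # ws))"
        "last (v # ws) \<in> verts K" by auto
    then show ?thesis using wss(2) by (intro bexI [of _ "last (v # ws)"]) simp_all
  next
    case False
    moreover have "v < 112" using assms(1) v by blast
    ultimately have "v = 109 \<or> v = 110 \<or> v = 111" by linarith
    then have "v \<in> ?L \<inter> verts K" using v by blast
    then show ?thesis by (intro bexI [of _ v] reachable_refl)
  qed
  have leaves: "reachable K l m" if lm: "l \<in> ?L \<inter> verts K" "m \<in> ?L \<inter> verts K" for l m
  proof (cases "l = m")
    case False
    then consider wss where "fan l [m] wss" | wss where "fan m [l] wss"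
      using fan_between_leaves [of l m] lm by blast
    then show ?thesis
    proof cases
      case 1
      then show ?thesis using fans [OF 1] lm by auto
    next
      case 2
      then show ?thesis using fans [OF 2] lm by (auto intro: reachable_sym)
    qed
  qed (simp add: reachable_refl)
  have "reachable K u v" if "u \<in> verts K" "v \<in> verts K" for u v
    using to_leaf [OF that(1)] to_leaf [OF that(2)] leaves
    by (meson reachable_sym reachable_trans)
  then show ?thesis using assms(2) by (simp add: connected_graph_def)
qed

lemma connected_delete_edges_H:
  assumes "finite F" "card F < 3"
  shows "connected_graph (delete_edges graph_H F)"
proof (rule connected_by_fans)
  fix v ts wss assume fan: "fan v ts wss" and V: "insert v (set ts) \<subseteq> verts (delete_edges graph_H F)"
  obtain ws where ws: "ws \<in> set wss" "reachable (delete_edges graph_H F) v (last (v # ws @ ts))"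
    using fan_edge_deletion [OF fan assms] by blast
  have "walk adj_H (v # ws @ ts)" using fan ws by (auto simp: fan_def list_all_iff)
  then have "last (v # ws @ ts) < 112"
    using V by (intro walk_last_less) (auto simp: delete_edges_def verts_H)
  then show "\<exists>ws\<in>set wss. reachable (delete_edges graph_H F) v (last (v # ws @ ts)) \<and>
      last (v # ws @ ts) \<in> verts (delete_edges graph_H F)"
    using ws by (intro bexI [of _ ws] conjI) (simp_all only: delete_edges_def verts_H ugraph.simps lessThan_iff Diff_iff not_False_eq_True simp_thms)
qed (auto simp: delete_edges_def verts_H lessThan_empty_iff)

lemma connected_delete_verts_H:
  assumes "finite S" "card S < 3"
  shows "connected_graph (delete_verts graph_H S)"
proof (rule connected_by_fans)
  have "\<not> {..<112} \<subseteq> S"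
    using assms card_mono [of S "{..<112}"] by auto
  then show "verts (delete_verts graph_H S) \<noteq> {}" by (auto simp: delete_verts_def verts_H)
  fix v ts wss assume fan: "fan v ts wss" and V: "insert v (set ts) \<subseteq> verts (delete_verts graph_H S)"
  then have "v \<notin> S" "set ts \<inter> S = {}" by (auto simp: delete_verts_def)
  then obtain ws where ws: "ws \<in> set wss" "set ws \<inter> S = {}"
      "reachable (delete_verts graph_H S) v (last (v # ws @ ts))"
    using fan_vertex_deletion [OF fan assms] by blast
  have "walk adj_H (v # ws @ ts)" using fan ws by (auto simp: fan_def list_all_iff)
  then have "last (v # ws @ ts) < 112"
    using V by (intro walk_last_less) (auto simp: delete_verts_def verts_H)
  moreover have "last (v # ws @ ts) \<in> set (v # ws @ ts)" by (rule last_in_set) simp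
  then have "last (v # ws @ ts) \<notin> S" using ws(2) \<open>v \<notin> S\<close> \<open>set ts \<inter> S = {}\<close> by auto
  ultimately show "\<exists>ws\<in>set wss. reachable (delete_verts graph_H S) v (last (v # ws @ ts)) \<and>
      last (v # ws @ ts) \<in> verts (delete_verts graph_H S)"
    using ws by (intro bexI [of _ ws] conjI) (simp_all only: delete_verts_def verts_H ugraph.simps lessThan_iff Diff_iff not_False_eq_True simp_thms)
qed (auto simp: delete_verts_def verts_H)

lemma connected_H: "connected_graph graph_H"
proof -
  have "delete_edges graph_H {} = graph_H" by (cases graph_H) (simp add: delete_edges_def)
  then show ?thesis using connected_delete_edges_H [of "{}"] by simp
qed

lemma bridgeless_H: "bridgeless graph_H"
  unfolding bridgeless_def is_bridge_def
proof
  assume "\<exists>e. e \<in> edges graph_H \<and> (\<exists>u\<in>e. \<exists>v\<in>e. \<not> reachable (delete_edges graph_H {e}) u v)"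
  then obtain e u v where e: "e \<in> edges graph_H" "u \<in> e" "v \<in> e"
      and not: "\<not> reachable (delete_edges graph_H {e}) u v"
    by blast
  then have "u \<in> verts (delete_edges graph_H {e})" "v \<in> verts (delete_edges graph_H {e})"
    using simple_graph_H by (auto simp: simple_graph_def delete_edges_def)
  then show False using connected_delete_edges_H [of "{e}"] not by (auto simp: connected_graph_def)
qed

lemma isolated_not_connected:
  assumes "u \<in> verts K" "v \<in> verts K" "u \<noteq> v" "\<And>e. e \<in> edges K \<Longrightarrow> u \<notin> e"
  shows "\<not> connected_graph K"
proof -
  have "\<not> reachable K u v"
  proof
    assume "reachable K u v"
    then show False
      unfolding reachable_def using assms(3,4) by (cases rule: converse_rtranclE) auto
  qed
  then show ?thesis using assms(1,2) by (auto simp: connected_graph_def)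
qed

lemma edge_connectivity_H: "edge_connectivity graph_H = 3"
  unfolding edge_connectivity_def
proof (rule cInf_eq_minimum)
  have "\<not> connected_graph (delete_edges graph_H (incident graph_H 0))"
    by (rule isolated_not_connected [of 0 _ 1]) (auto simp: delete_edges_def verts_H incident_def)
  then show "3 \<in> {card F |F. finite F \<and> F \<subseteq> edges graph_H \<and> \<not> connected_graph (delete_edges graph_H F)}"
    using card_incident_H [of 0] by (force simp: incident_def intro: finite_subset [OF _ finite_edges_H])
next
  fix k assume "k \<in> {card F |F. finite F \<and> F \<subseteq> edges graph_H \<and> \<not> connected_graph (delete_edges graph_H F)}"
  then show "3 \<le> k" using connected_delete_edges_H by (force simp: not_less [symmetric])
qed

lemma vertex_connectivity_H: "vertex_connectivity graph_H = 3"
  unfolding vertex_connectivity_def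
proof (rule cInf_eq_minimum)
  \<comment> \<open>The leaves are the three neighbours of the center 108, so deleting them isolates
    it.\<close>
  have "\<not> connected_graph (delete_verts graph_H {109, 110, 111})"
  proof (rule isolated_not_connected [of 108 _ 0])
    fix e assume e: "e \<in> edges (delete_verts graph_H {109, 110, 111})"
    show "108 \<notin> e"
    proof
      assume "108 \<in> e"
      with e have "e \<in> incident graph_H 108" by (auto simp: incident_def delete_verts_def)
      then show False using e by (auto simp: incident_H adj_H_simps delete_verts_def)
    qed
  qed (auto simp: delete_verts_def verts_H)
  then show "3 \<in> {card S |S. finite S \<and> S \<subseteq> verts graph_H \<and>
      (\<not> connected_graph (delete_verts graph_H S) \<or> card (verts graph_H - S) = 1)}"
    by (intro CollectI exI [of _ "{109, 110, 111}"]) (auto simp: verts_H)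
next
  fix k assume "k \<in> {card S |S. finite S \<and> S \<subseteq> verts graph_H \<and>
      (\<not> connected_graph (delete_verts graph_H S) \<or> card (verts graph_H - S) = 1)}"
  then obtain S where S: "k = card S" "finite S" "S \<subseteq> {..<112}"
      "\<not> connected_graph (delete_verts graph_H S) \<or> card ({..<112} - S) = 1"
    by (auto simp: verts_H)
  show "3 \<le> k"
  proof (rule ccontr)
    assume "\<not> 3 \<le> k"
    with S connected_delete_verts_H have "card ({..<112} - S) = 1" by auto
    \<comment> \<open>At least 110 vertices survive, so the alternative of a single remaining vertex
      is impossible.\<close>
    with S \<open>\<not> 3 \<le> k\<close> show False by (simp add: card_Diff_subset)
  qed
qed

section \<open>Colorings\<close>

type_synonym dart = "nat \<times> nat \<times> nat"

text \<open>
  Along the edge \<open>uv\<close>, a coloring has the dart \<open>(k, a, b)\<close> at \<open>u\<close>: here \<open>k\<close> is the color of \<open>uv\<close>, and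
  \<open>a < b\<close> are the colors of the other two edges at \<open>u\<close>.  Normality of \<open>uv\<close> says that the dart at \<open>v\<close>
  is the same one or has the two remaining colors instead of \<open>a\<close> and \<open>b\<close>.
\<close>

definition mk_dart :: "nat \<Rightarrow> nat \<Rightarrow> nat \<Rightarrow> dart" where
  "mk_dart k a b = (if a \<le> b then (k, a, b) else (k, b, a))"

definition dart :: "(nat set \<Rightarrow> nat) \<Rightarrow> nat \<times> nat \<Rightarrow> dart" where
  "dart c = (\<lambda>(u, v). let ws = filter (\<lambda>w. w \<noteq> v) (adj_H u)
     in mk_dart (c {u, v}) (c {u, ws ! 0}) (c {u, ws ! 1}))"

fun other_colors :: "dart \<Rightarrow> nat list" where
  "other_colors (k, a, b) = filter (\<lambda>x. x \<noteq> k \<and> x \<noteq> a \<and> x \<noteq> b) [0..<5]"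

fun vertex_gen :: "dart \<Rightarrow> dart list list" where
  "vertex_gen (k, a, b) =
     [[mk_dart a k b, mk_dart b k a], [mk_dart b k a, mk_dart a k b]]"

definition cross_gen :: "dart \<Rightarrow> dart list list" where
  "cross_gen s = [[s], [(fst s, other_colors s ! 0, other_colors s ! 1)]]"

fun recolor :: "nat list \<Rightarrow> dart \<Rightarrow> dart" where
  "recolor \<sigma> (k, a, b) = mk_dart (\<sigma> ! k) (\<sigma> ! a) (\<sigma> ! b)"

text \<open>A permutation of the colors, as the list of its values, that carries the dart
  \<open>(0, 1, 2)\<close> to the given one.\<close>

fun standard_perm :: "dart \<Rightarrow> nat list" where
  "standard_perm (k, a, b) = k # a # b # other_colors (k, a, b)"

definition block_gen :: "dart list list \<Rightarrow> dart \<Rightarrow> dart list list" where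
  "block_gen T s = map (map (recolor (standard_perm s))) T"

text \<open>
  The graph \<open>graph_H\<close> consists of twelve copies of the four-pole \<open>P\<close>, which is the Petersen graph without
  two adjacent vertices, and 16 further vertices.  The rows are the possible darts at the last three
  semiedges of \<open>P\<close> (and of \<open>Q\<close>, respectively) when the dart at the first one is \<open>(0, 1, 2)\<close>.
\<close>

definition P_table :: "dart list list" where
  "P_table =
    [[(0, 1, 2), (0, 1, 2), (0, 1, 2)], [(1, 0, 2), (1, 0, 2), (0, 1, 2)], [(1, 0, 3), (2, 0,
     3), (3, 1, 2)], [(1, 0, 4), (2, 0, 4), (4, 1, 2)], [(2, 0, 1), (2, 0, 1), (0, 1, 2)], [(2,
     0, 3), (1, 0, 3), (3, 1, 2)], [(2, 0, 4), (1, 0, 4), (4, 1, 2)], [(3, 1, 4), (3, 1, 4), (0,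
     1, 2)], [(3, 2, 4), (3, 2, 4), (0, 1, 2)], [(4, 1, 3), (4, 1, 3), (0, 1, 2)], [(4, 2, 3),
     (4, 2, 3), (0, 1, 2)]]"

definition Q_table :: "dart list list" where
  "Q_table =
    [[(0, 3, 4), (0, 1, 3), (0, 2, 4)], [(0, 3, 4), (0, 1, 4), (0, 2, 3)], [(0, 3, 4), (0, 2,
     3), (0, 1, 4)], [(0, 3, 4), (0, 2, 4), (0, 1, 3)], [(0, 3, 4), (1, 0, 3), (1, 2, 4)], [(0,
     3, 4), (1, 0, 4), (1, 2, 3)], [(0, 3, 4), (1, 2, 3), (1, 0, 4)], [(0, 3, 4), (1, 2, 4), (1,
     0, 3)], [(0, 3, 4), (2, 0, 3), (2, 1, 4)], [(0, 3, 4), (2, 0, 4), (2, 1, 3)], [(0, 3, 4),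
     (2, 1, 3), (2, 0, 4)], [(0, 3, 4), (2, 1, 4), (2, 0, 3)], [(0, 3, 4), (3, 0, 1), (3, 2,
     4)], [(0, 3, 4), (3, 0, 2), (3, 1, 4)], [(0, 3, 4), (3, 1, 4), (3, 0, 2)], [(0, 3, 4), (3,
     2, 4), (3, 0, 1)], [(0, 3, 4), (4, 0, 1), (4, 2, 3)], [(0, 3, 4), (4, 0, 2), (4, 1, 3)],
     [(0, 3, 4), (4, 1, 3), (4, 0, 2)], [(0, 3, 4), (4, 2, 3), (4, 0, 1)], [(1, 3, 4), (0, 3,
     4), (1, 3, 4)], [(1, 3, 4), (1, 3, 4), (0, 3, 4)], [(2, 3, 4), (0, 3, 4), (2, 3, 4)], [(2,
     3, 4), (2, 3, 4), (0, 3, 4)], [(3, 0, 4), (0, 1, 2), (3, 1, 2)], [(3, 0, 4), (3, 1, 2), (0,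
     1, 2)], [(3, 1, 2), (0, 1, 2), (3, 0, 4)], [(3, 1, 2), (0, 3, 4), (3, 1, 2)], [(3, 1, 2),
     (3, 0, 4), (0, 1, 2)], [(3, 1, 2), (3, 1, 2), (0, 3, 4)], [(4, 0, 3), (0, 1, 2), (4, 1,
     2)], [(4, 0, 3), (4, 1, 2), (0, 1, 2)], [(4, 1, 2), (0, 1, 2), (4, 0, 3)], [(4, 1, 2), (0,
     3, 4), (4, 1, 2)], [(4, 1, 2), (4, 0, 3), (0, 1, 2)], [(4, 1, 2), (4, 1, 2), (0, 3, 4)]]"

text \<open>Instructions refer to positions in an environment of darts, newest first.
  \<open>Vertex\<close> passes to the other two edges at the same vertex, \<open>Cross\<close> to
  the other end of an edge, and the blocks to the remaining semiedges of a four-pole;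
  \<open>Close\<close> tests an edge that has been reached from both ends. Darts do not record their
  place: \<open>run_names\<close> tracks it in parallel, so a single run serves all copies of a
  block.\<close>

datatype instr =
    Vertex nat nat nat
  | Cross nat
  | Close nat nat
  | P_block nat "(nat \<times> nat) list"
  | Q_block nat "(nat \<times> nat) list"

fun gen :: "instr \<Rightarrow> dart list \<Rightarrow> dart list list" where
  "gen (Vertex i x y) env = vertex_gen (env ! i)"
| "gen (Cross i) env = cross_gen (env ! i)"
| "gen (Close i j) env = (if [env ! j] \<in> set (cross_gen (env ! i)) then [[]] else [])"
| "gen (P_block i ns) env = block_gen P_table (env ! i)"
| "gen (Q_block i ns) env = block_gen Q_table (env ! i)"

fun new_names :: "instr \<Rightarrow> (nat \<times> nat) list \<Rightarrow> (nat \<times> nat) list" where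
  "new_names (Vertex i x y) names = [(fst (names ! i), x), (fst (names ! i), y)]"
| "new_names (Cross i) names = [(snd (names ! i), fst (names ! i))]"
| "new_names (Close i j) names = []"
| "new_names (P_block i ns) names = ns"
| "new_names (Q_block i ns) names = ns"

fun run :: "instr list \<Rightarrow> dart list \<Rightarrow> dart list list" where
  "run [] env = [env]"
| "run (p # ps) env = concat (map (\<lambda>ds. run ps (ds @ env)) (gen p env))"

fun run_names :: "instr list \<Rightarrow> (nat \<times> nat) list \<Rightarrow> (nat \<times> nat) list" where
  "run_names [] names = names"
| "run_names (p # ps) names = run_names ps (new_names p names @ names)"

text \<open>
  A program runs on a template whose vertices are placed in \<open>graph_H\<close> by \<open>h\<close>.  The lists \<open>P\<close> and \<open>R\<close>
  contain the placements for which the tables of the two kinds of blocks have been established.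
\<close>

type_synonym site = "(nat \<times> nat) \<times> (nat \<times> nat) list"

fun fits1 :: "site list \<Rightarrow> site list \<Rightarrow> (nat \<Rightarrow> nat) \<Rightarrow> instr \<Rightarrow> (nat \<times> nat) list \<Rightarrow> bool" where
  "fits1 P R h (Vertex i x y) names \<longleftrightarrow> i < length names \<and>
     h (fst (names ! i)) < 112 \<and> distinct [h (snd (names ! i)), h x, h y] \<and>
     h (snd (names ! i)) \<in> set (adj_H (h (fst (names ! i)))) \<and>
     h x \<in> set (adj_H (h (fst (names ! i)))) \<and> h y \<in> set (adj_H (h (fst (names ! i))))"
| "fits1 P R h (Cross i) names \<longleftrightarrow> i < length names \<and>
     h (fst (names ! i)) < 112 \<and> h (snd (names ! i)) \<in> set (adj_H (h (fst (names ! i))))"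
| "fits1 P R h (Close i j) names \<longleftrightarrow> i < length names \<and> j < length names \<and>
     fst (names ! j) = snd (names ! i) \<and> snd (names ! j) = fst (names ! i) \<and>
     h (fst (names ! i)) < 112 \<and> h (snd (names ! i)) \<in> set (adj_H (h (fst (names ! i))))"
| "fits1 P R h (P_block i ns) names \<longleftrightarrow> i < length names \<and>
     (map_prod h h (names ! i), map (map_prod h h) ns) \<in> set P"
| "fits1 P R h (Q_block i ns) names \<longleftrightarrow> i < length names \<and>
     (map_prod h h (names ! i), map (map_prod h h) ns) \<in> set R"

fun fits :: "site list \<Rightarrow> site list \<Rightarrow> (nat \<Rightarrow> nat) \<Rightarrow> instr list \<Rightarrow> (nat \<times> nat) list \<Rightarrow> bool" where
  "fits P R h [] names \<longleftrightarrow> True"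
| "fits P R h (p # ps) names \<longleftrightarrow> fits1 P R h p names \<and> fits P R h ps (new_names p names @ names)"

section \<open>Soundness of the search for darts\<close>

lemma mk_dart_commute: "mk_dart k a b = mk_dart k b a"
  by (auto simp: mk_dart_def)

lemma dart_eq:
  assumes "u < 112" "distinct [v, x, y]" "v \<in> set (adj_H u)" "x \<in> set (adj_H u)" "y \<in> set (adj_H u)"
  shows "dart c (u, v) = mk_dart (c {u, v}) (c {u, x}) (c {u, y})"
proof -
  have "length (adj_H u) = 3" "distinct (adj_H u)"
    using adj_H_checks assms(1) by (auto simp: list_all_iff)
  then obtain p q r where pqr: "adj_H u = [p, q, r]" "distinct [p, q, r]"
    by (auto simp: length_Suc_conv numeral_eq_Suc)
  then have "filter (\<lambda>w. w \<noteq> v) (adj_H u) \<in> {[x, y], [y, x]}"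
    using assms by auto
  then show ?thesis by (auto simp: dart_def Let_def mk_dart_commute)
qed

lemma adj_H_cases:
  assumes "u < 112" "v \<in> set (adj_H u)"
  obtains x y where "distinct [v, x, y]" "set (adj_H u) = {v, x, y}"
proof -
  have "card (set (adj_H u) - {v}) = 2" using adj_H_props(2) [OF assms(1)] assms(2) by simp
  then obtain x y where "set (adj_H u) - {v} = {x, y}" "x \<noteq> y" by (auto simp: card_2_iff)
  then have "distinct [v, x, y]" "set (adj_H u) = {v, x, y}" using assms(2) by auto
  then show ?thesis by (rule that)
qed

lemma adj_H_sym: "v \<in> set (adj_H u) \<longleftrightarrow> u \<in> set (adj_H v)"
  by (metis edge_H_iff insert_commute)

abbreviation normal_H :: "(nat set \<Rightarrow> nat) \<Rightarrow> bool" where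
  "normal_H \<equiv> normal_5_edge_coloring graph_H"

lemma normal_H_color_less: "normal_H c \<Longrightarrow> v \<in> set (adj_H u) \<Longrightarrow> c {u, v} < 5"
  by (simp add: normal_5_edge_coloring_def proper_edge_coloring_def edge_H_iff)

lemma normal_H_distinct:
  assumes "normal_H c" "distinct [v, x, y]" "set (adj_H u) = {v, x, y}"
  shows "distinct [c {u, v}, c {u, x}, c {u, y}]"
proof -
  have "c {u, p} \<noteq> c {u, q}" if "p \<in> set (adj_H u)" "q \<in> set (adj_H u)" "p \<noteq> q" for p q
  proof -
    have "{u, p} \<in> edges graph_H" "{u, q} \<in> edges graph_H" "{u, p} \<noteq> {u, q}" "{u, p} \<inter> {u, q} \<noteq> {}"
      using that by (auto simp: edge_H_iff doubleton_eq_iff)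
    moreover have "\<forall>e\<in>edges graph_H. \<forall>f\<in>edges graph_H. e \<noteq> f \<and> e \<inter> f \<noteq> {} \<longrightarrow> c e \<noteq> c f"
      using assms(1) by (simp add: normal_5_edge_coloring_def proper_edge_coloring_def)
    ultimately show ?thesis by simp
  qed
  then show ?thesis using assms(2,3) by auto
qed

lemma dart_props:
  assumes "normal_H c" "u < 112" "v \<in> set (adj_H u)"
  obtains k a b where "dart c (u, v) = (k, a, b)" "a < b" "k \<noteq> a" "k \<noteq> b" "k < 5" "a < 5" "b < 5"
proof -
  obtain x y where xy: "distinct [v, x, y]" "set (adj_H u) = {v, x, y}"
    using adj_H_cases assms by metis
  have "dart c (u, v) = mk_dart (c {u, v}) (c {u, x}) (c {u, y})"
    using xy assms by (intro dart_eq) auto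
  moreover have "distinct [c {u, v}, c {u, x}, c {u, y}]" using normal_H_distinct assms(1) xy .
  moreover have "c {u, v} < 5" "c {u, x} < 5" "c {u, y} < 5"
    using normal_H_color_less [OF assms(1)] xy(2) by auto
  ultimately show ?thesis
    by (cases "c {u, x} \<le> c {u, y}") (auto simp: mk_dart_def intro!: that)
qed

lemma vertex_gen_dart:
  assumes "u < 112" "distinct [v, x, y]" "v \<in> set (adj_H u)" "x \<in> set (adj_H u)" "y \<in> set (adj_H u)"
  shows "[dart c (u, x), dart c (u, y)] \<in> set (vertex_gen (dart c (u, v)))"
proof -
  have "dart c (u, v) = mk_dart (c {u, v}) (c {u, x}) (c {u, y})"
    "dart c (u, x) = mk_dart (c {u, x}) (c {u, v}) (c {u, y})"
    "dart c (u, y) = mk_dart (c {u, y}) (c {u, v}) (c {u, x})"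
    using assms by (auto intro: dart_eq)
  then show ?thesis by (cases "c {u, x} \<le> c {u, y}") (auto simp: mk_dart_def)
qed

lemma other_colors_eq:
  assumes "{k, a, b, p, q} = {..<5}" "card {k, a, b, p, q} = 5" "p < q"
  shows "other_colors (k, a, b) = [p, q]"
proof -
  have "distinct [k, a, b, p, q]" using assms(2) by (auto simp: card_insert_if split: if_splits)
  have "set (filter (\<lambda>x. x \<noteq> k \<and> x \<noteq> a \<and> x \<noteq> b) [0..<5]) = {..<5} - {k, a, b}"
    by auto
  also have "\<dots> = set [p, q]"
    unfolding assms(1) [symmetric] using \<open>distinct [k, a, b, p, q]\<close> by auto
  finally have "set (filter (\<lambda>x. x \<noteq> k \<and> x \<noteq> a \<and> x \<noteq> b) [0..<5]) = set [p, q]" .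
  then show ?thesis
    unfolding other_colors.simps
    by (intro sorted_distinct_set_unique) (use assms(3) in \<open>simp_all add: sorted_wrt_filter\<close>)
qed

lemma cross_gen_dart:
  assumes c: "normal_H c" and uv: "u < 112" "v \<in> set (adj_H u)"
  shows "[dart c (v, u)] \<in> set (cross_gen (dart c (u, v)))"
proof -
  have vu: "v < 112" "u \<in> set (adj_H v)" using uv adj_H_props(1) adj_H_sym by auto
  obtain x y where xy: "distinct [v, x, y]" "set (adj_H u) = {v, x, y}"
    using adj_H_cases uv by metis
  obtain z w where zw: "distinct [u, z, w]" "set (adj_H v) = {u, z, w}"
    using adj_H_cases vu by metis
  define k a b p q where "k = c {u, v}" "a = c {u, x}" "b = c {u, y}" "p = c {v, z}" "q = c {v, w}"
  note defs = this
  have dart_u: "dart c (u, v) = mk_dart k a b"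
    using xy uv unfolding defs by (intro dart_eq) auto
  have dart_v: "dart c (v, u) = mk_dart k p q"
    using zw vu dart_eq [of v u z w c] unfolding defs by (simp add: insert_commute)
  have kab: "distinct [k, a, b]" unfolding defs by (rule normal_H_distinct [OF c xy])
  have kpq: "distinct [k, p, q]"
    using normal_H_distinct [OF c zw] unfolding defs by (simp add: insert_commute)
  have less: "{k, a, b, p, q} \<subseteq> {..<5}"
    using normal_H_color_less [OF c] xy(2) zw(2) uv unfolding defs by auto
  have "c ` (incident graph_H u \<union> incident graph_H v) = {k, a, b, p, q}"
    unfolding incident_H xy(2) zw(2) defs by (auto simp: insert_commute)
  moreover have "card (c ` (incident graph_H u \<union> incident graph_H v)) \<in> {3, 5}"
    using c uv by (simp add: normal_5_edge_coloring_def edge_H_iff)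
  ultimately consider "card {k, a, b, p, q} = 3" | "card {k, a, b, p, q} = 5" by auto
  then show ?thesis
  proof cases
    case 1
    moreover have "card {k, a, b} = 3" "card {k, p, q} = 3" using kab kpq by auto
    ultimately have "{k, a, b} = {k, a, b, p, q}" "{k, p, q} = {k, a, b, p, q}"
      by (intro card_subset_eq; simp; blast)+
    then have "{a, b} = {p, q}" using kab kpq by auto
    then have "mk_dart k p q = mk_dart k a b" by (auto simp: doubleton_eq_iff mk_dart_commute)
    then show ?thesis by (simp add: cross_gen_def dart_u dart_v)
  next
    case 2
    then have all: "{k, a, b, p, q} = {..<5}" using less by (intro card_subset_eq) auto
    \<comment> \<open>Sorting in \<open>mk_dart\<close> may have exchanged \<open>a\<close> and
      \<open>b\<close>, so both orders are treated.\<close>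
    have others: "other_colors (k, a', b') = [min p q, max p q]" if "{a', b'} = {a, b}" for a' b'
    proof -
      have "{k, a', b', x, y} = {k} \<union> {a', b'} \<union> {x, y}" for x y by auto
      then have eq: "{k, a', b', p, q} = {k, a, b, p, q}" "{k, a', b', q, p} = {k, a, b, p, q}"
        unfolding that by auto
      show ?thesis
      proof (cases "p < q")
        case True
        then show ?thesis using other_colors_eq [of k a' b' p q] all 2 eq by simp
      next
        case False
        then have "q < p" using kpq by auto
        then show ?thesis using other_colors_eq [of k a' b' q p] all 2 eq by simp
      qed
    qed
    have [simp]: "other_colors (k, a, b) = [min p q, max p q]" "other_colors (k, b, a) = [min p q, max p q]"
      by (rule others, blast)+
    have "dart c (v, u) = (k, min p q, max p q)" by (auto simp: dart_v mk_dart_def)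
    then show ?thesis by (simp add: cross_gen_def dart_u mk_dart_def del: other_colors.simps)
  qed
qed

text \<open>Normality depends only on which colors agree and on how many occur, and an injective
  recoloring changes neither.\<close>

lemma inj_comp_normal_H:
  assumes "normal_H c" "inj_on g {..<5}" "g ` {..<5} \<subseteq> {..<5}"
  shows "normal_H (g \<circ> c)"
proof -
  have less: "c e < 5" if "e \<in> edges graph_H" for e
    using assms(1) that by (simp add: normal_5_edge_coloring_def proper_edge_coloring_def)
  have "g x < 5" if "x < 5" for x using assms(3) that by auto
  moreover have "card ((g \<circ> c) ` (incident graph_H u \<union> incident graph_H v)) =
      card (c ` (incident graph_H u \<union> incident graph_H v))" for u v
    unfolding image_comp [symmetric]
    using less by (intro card_image inj_on_subset [OF assms(2)]) (auto simp: incident_def)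
  ultimately show ?thesis
    using assms less unfolding normal_5_edge_coloring_def proper_edge_coloring_def
    by (auto simp: inj_on_eq_iff [OF assms(2)])
qed

lemma dart_comp:
  assumes "u < 112" "v \<in> set (adj_H u)" "dart c (u, v) = (k, a, b)"
  shows "dart (g \<circ> c) (u, v) = mk_dart (g k) (g a) (g b)"
proof -
  obtain x y where xy: "distinct [v, x, y]" "set (adj_H u) = {v, x, y}"
    using adj_H_cases assms by metis
  have "dart c' (u, v) = mk_dart (c' {u, v}) (c' {u, x}) (c' {u, y})" for c'
    using xy assms by (intro dart_eq) auto
  then show ?thesis
    using assms(3) by (auto simp: mk_dart_def split: if_splits)
qed

text \<open>
  Permuting the colors, it suffices to compute the darts of a block for a single value of one of them.
\<close>

lemma block_gen_dart:
  assumes standard: "\<And>c. normal_H c \<Longrightarrow> dart c n = (0, 1, 2) \<Longrightarrow> map (dart c) ns \<in> set T"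
    and names: "\<And>u v. (u, v) \<in> set (n # ns) \<Longrightarrow> u < 112 \<and> v \<in> set (adj_H u)"
    and c: "normal_H c"
  shows "map (dart c) ns \<in> set (block_gen T (dart c n))"
proof -
  obtain k a b where s: "dart c n = (k, a, b)" "a < b" "k \<noteq> a" "k \<noteq> b" "k < 5" "a < 5" "b < 5"
    using dart_props [OF c] names by (metis list.set_intros(1) surj_pair)
  define \<sigma> where "\<sigma> = standard_perm (k, a, b)"
  have rest: "set (other_colors (k, a, b)) = {..<5} - {k, a, b}" "distinct (other_colors (k, a, b))"
    by (auto simp: lessThan_atLeast0)
  have "set \<sigma> = {k, a, b} \<union> ({..<5} - {k, a, b})"
    unfolding \<sigma>_def standard_perm.simps list.set rest by auto
  then have \<sigma>_set: "set \<sigma> = {..<5}" using s by auto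
  have "distinct \<sigma>"
    unfolding \<sigma>_def standard_perm.simps distinct.simps list.set rest using s rest(2) by simp
  with \<sigma>_set have \<sigma>_length: "length \<sigma> = 5" using distinct_card by fastforce
  have bij: "bij_betw ((!) \<sigma>) {..<5} {..<5}"
    using bij_betw_nth [OF \<open>distinct \<sigma>\<close>] \<sigma>_set \<sigma>_length by auto
  \<comment> \<open>\<open>g\<close> inverts the permutation: \<open>g \<circ> c\<close> has the
    dart \<open>(0, 1, 2)\<close> at \<open>n\<close>, so \<open>T\<close> applies to it, and
    \<open>recolor \<sigma>\<close> leads back to \<open>c\<close>.\<close>
  define g where "g = inv_into {..<5} ((!) \<sigma>)"
  have g_less: "g x < 5" and nth_g: "\<sigma> ! g x = x" if "x < 5" for x
    using that bij by (auto simp: g_def bij_betw_def inv_into_into f_inv_into_f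
      dest: bij_betw_imp_surj_on [OF bij_betw_inv_into])
      (metis inv_into_into lessThan_iff)
  have g_nth: "g (\<sigma> ! i) = i" if "i < 5" for i
    using that bij by (auto simp: g_def bij_betw_def)
  have g_inj: "inj_on g {..<5}" using nth_g by (metis inj_onI lessThan_iff)
  have normal: "normal_H (g \<circ> c)"
    using c g_inj g_less by (intro inj_comp_normal_H) auto
  have "g k = 0" "g a = 1" "g b = 2"
    using g_nth [of 0] g_nth [of 1] g_nth [of 2] by (simp_all add: \<sigma>_def numeral_2_eq_2)
  then have "dart (g \<circ> c) n = (0, 1, 2)"
    using dart_comp [of "fst n" "snd n" c] names [of "fst n" "snd n"] s(1) by (simp add: mk_dart_def)
  then have "map (dart (g \<circ> c)) ns \<in> set T" using standard normal by blast
  moreover have "dart c m = recolor \<sigma> (dart (g \<circ> c) m)" if "m \<in> set ns" for m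
  proof -
    obtain u v where m: "m = (u, v)" by (cases m)
    have "u < 112" "v \<in> set (adj_H u)" using names m that by auto
    then obtain k a b where d: "dart c (u, v) = (k, a, b)" "a < b" "k < 5" "a < 5" "b < 5"
      using dart_props [OF c] by metis
    have "dart (g \<circ> c) (u, v) = mk_dart (g k) (g a) (g b)"
      by (rule dart_comp [OF \<open>u < 112\<close> \<open>v \<in> set (adj_H u)\<close> d(1)])
    then show ?thesis using d nth_g by (auto simp: m mk_dart_def)
  qed
  then have "map (dart c) ns = map (recolor \<sigma>) (map (dart (g \<circ> c)) ns)" by simp
  ultimately show ?thesis
    unfolding block_gen_def s(1) \<sigma>_def [symmetric] set_map by (rule image_eqI [rotated])
qed

definition established :: "(nat set \<Rightarrow> nat) \<Rightarrow> dart list list \<Rightarrow> site list \<Rightarrow> bool" where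
  "established c T S \<longleftrightarrow> (\<forall>(n, ns)\<in>set S. map (dart c) ns \<in> set (block_gen T (dart c n)))"

lemma gen_sound:
  assumes "normal_H c" "established c P_table P" "established c Q_table R"
    and "fits1 P R h p names"
  shows "map (dart c \<circ> map_prod h h) (new_names p names) \<in>
    set (gen p (map (dart c \<circ> map_prod h h) names))"
proof (cases p)
  case (Vertex i x y)
  then show ?thesis
    using assms(4) vertex_gen_dart [of "h (fst (names ! i))" "h (snd (names ! i))" "h x" "h y" c]
    by (cases "names ! i") auto
next
  case (Cross i)
  then show ?thesis
    using assms(4) cross_gen_dart [OF assms(1), of "h (fst (names ! i))" "h (snd (names ! i))"]
    by (cases "names ! i") auto
next
  case (Close i j)
  then show ?thesis
    using assms(4) cross_gen_dart [OF assms(1), of "h (fst (names ! i))" "h (snd (names ! i))"]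
    by (cases "names ! i"; cases "names ! j") auto
next
  case (P_block i ns)
  then show ?thesis using assms(2,4) by (auto simp: established_def)
next
  case (Q_block i ns)
  then show ?thesis using assms(3,4) by (auto simp: established_def)
qed

text \<open>The darts of an actual normal coloring are among the choices of every instruction and
  pass every \<open>Close\<close>, so they form one of the surviving environments. An empty output
  thus excludes colorings.\<close>

lemma run_sound:
  assumes "normal_H c" "established c P_table P" "established c Q_table R"
  shows "fits P R h ps names \<Longrightarrow>
    map (dart c \<circ> map_prod h h) (run_names ps names) \<in> set (run ps (map (dart c \<circ> map_prod h h) names))"
proof (induction ps arbitrary: names)
  case (Cons p ps)
  have "map (dart c \<circ> map_prod h h) (new_names p names) \<in> set (gen p (map (dart c \<circ> map_prod h h) names))"
    using gen_sound [OF assms] Cons.prems by simp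
  moreover have "map (dart c \<circ> map_prod h h) (run_names ps (new_names p names @ names)) \<in>
      set (run ps (map (dart c \<circ> map_prod h h) (new_names p names) @ map (dart c \<circ> map_prod h h) names))"
    using Cons.IH [of "new_names p names @ names"] Cons.prems by (simp only: map_append fits.simps)
  ultimately show ?case
    by (simp only: run.simps run_names.simps set_concat set_map) blast
qed simp

text \<open>The earlier tables are assumed for all normal colorings because
  \<open>block_gen_dart\<close> replaces \<open>c\<close> by a recoloring. The list
  \<open>out\<close> selects from a final environment the darts at the remaining semiedges.\<close>

lemma established_by_run:
  assumes P: "\<And>c. normal_H c \<Longrightarrow> established c P_table P"
    and R: "\<And>c. normal_H c \<Longrightarrow> established c Q_table R"
    and "normal_H c"
    and fits: "fits P R h ps [n]"
    and table: "list_all (\<lambda>env. map ((!) env) out \<in> set T) (run ps [(0, 1, 2)])"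
    and out: "list_all (\<lambda>i. i < length (run_names ps [n])) out" "ns = map ((!) (run_names ps [n])) out"
    and names: "list_all (\<lambda>(u, v). h u < 112 \<and> h v \<in> set (adj_H (h u))) (n # ns)"
  shows "map (dart c) (map (map_prod h h) ns) \<in> set (block_gen T (dart c (map_prod h h n)))"
proof (rule block_gen_dart [OF _ _ \<open>normal_H c\<close>])
  fix c assume c: "normal_H c" "dart c (map_prod h h n) = (0, 1, 2)"
  have "map (dart c \<circ> map_prod h h) (run_names ps [n]) \<in> set (run ps [(0, 1, 2)])"
    using run_sound [OF c(1) P [OF c(1)] R [OF c(1)] fits] c(2) by simp
  then have "map ((!) (map (dart c \<circ> map_prod h h) (run_names ps [n]))) out \<in> set T"
    using table by (auto simp: list_all_iff)
  moreover have "map ((!) (map (dart c \<circ> map_prod h h) (run_names ps [n]))) out =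
      map (dart c) (map (map_prod h h) ns)"
    using out by (auto simp: list_all_iff)
  ultimately show "map (dart c) (map (map_prod h h) ns) \<in> set T" by simp
next
  fix u v assume "(u, v) \<in> set (map_prod h h n # map (map_prod h h) ns)"
  then show "u < 112 \<and> v \<in> set (adj_H u)"
    using names by (cases n) (auto simp: list_all_iff)
qed

section \<open>The relations of the four-poles and their incompatibility\<close>

definition P_program :: "instr list" where
  "P_program =
    [Vertex 0 1 5, Cross 0, Vertex 0 2 6, Cross 0, Vertex 0 7 9, Cross 7, Vertex 0 3 7, Cross 3,
     Vertex 0 4 5, Close 1 4, Cross 3, Vertex 0 6 10, Cross 13, Vertex 0 3 4, Close 0 3, Cross
     1, Vertex 0 7 11, Close 0 9]"

text \<open>Entries 0 to 7 place the vertices of the block, entries 8 to 11 the outer neighbours of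
  its vertices 0, 2, 3, 4. Each copy is placed so that its vertex 0 is where
  \<open>Q_program\<close> enters it; there are four copies in each \<open>Q\<close>.\<close>

definition P_maps :: "nat list list" where
  "P_maps =
    [[2, 1, 0, 4, 3, 7, 6, 5, 52, 31, 9, 11], [31, 33, 28, 32, 30, 34, 35, 29, 0, 11, 111, 23],
     [23, 25, 20, 24, 22, 26, 27, 21, 30, 10, 109, 15], [15, 17, 12, 16, 14, 18, 19, 13, 22, 10,
     74, 9], [38, 37, 36, 40, 39, 43, 42, 41, 88, 67, 45, 47], [67, 69, 64, 68, 66, 70, 71, 65,
     36, 47, 109, 59], [59, 61, 56, 60, 58, 62, 63, 57, 66, 46, 110, 51], [51, 53, 48, 52, 50,
     54, 55, 49, 58, 46, 2, 45], [74, 73, 72, 76, 75, 79, 78, 77, 16, 103, 81, 83], [103, 105,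
     100, 104, 102, 106, 107, 101, 72, 83, 110, 95], [95, 97, 92, 96, 94, 98, 99, 93, 102, 82,
     111, 87], [87, 89, 84, 88, 86, 90, 91, 85, 94, 82, 38, 81]]"

definition P_sites :: "site list" where
  "P_sites = map (\<lambda>h. ((h ! 0, h ! 8), [(h ! 2, h ! 9), (h ! 3, h ! 10), (h ! 4, h ! 11)])) P_maps"

definition Q_program :: "instr list" where
  "Q_program =
    [P_block 0 [(0, 31), (4, 9), (3, 11)], Cross 0, P_block 0 [(28, 11), (32, 37), (30, 23)],
     Cross 6, Vertex 0 8 28, Close 3 1, Cross 0, Vertex 0 9 10, Cross 11, Vertex 0 8 14, Close 3
     0, Cross 11, P_block 0 [(20, 10), (24, 38), (22, 15)], Cross 8, Vertex 0 12 20, Close 3 1,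
     Cross 5, P_block 0 [(12, 10), (16, 39), (14, 9)], Close 0 4, Close 2 12]"

text \<open>The entries 36 to 39 are the neighbours across the semiedges 0 to 3, which differ from
  copy to copy.\<close>

definition Q_maps :: "nat list list" where
  "Q_maps =
    [[0, 1, 2, 3, 4, 5, 6, 7, 8, 9, 10, 11, 12, 13, 14, 15, 16, 17, 18, 19, 20, 21, 22, 23, 24,
     25, 26, 27, 28, 29, 30, 31, 32, 33, 34, 35, 52, 111, 109, 74], [36, 37, 38, 39, 40, 41, 42,
     43, 44, 45, 46, 47, 48, 49, 50, 51, 52, 53, 54, 55, 56, 57, 58, 59, 60, 61, 62, 63, 64, 65,
     66, 67, 68, 69, 70, 71, 88, 109, 110, 2], [72, 73, 74, 75, 76, 77, 78, 79, 80, 81, 82, 83,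
     84, 85, 86, 87, 88, 89, 90, 91, 92, 93, 94, 95, 96, 97, 98, 99, 100, 101, 102, 103, 104,
     105, 106, 107, 16, 110, 111, 38]]"

definition Q_sites :: "site list" where
  "Q_sites = map (\<lambda>h. ((h ! 2, h ! 36), [(h ! 32, h ! 37), (h ! 24, h ! 38), (h ! 16, h ! 39)])) Q_maps"

text \<open>Starting with the dart at 2 towards 52, the program walks around the ring through the
  first, third and second copies of \<open>Q\<close>, requires the ring to close up, and checks the
  three leaves and the center.\<close>

definition H_program :: "instr list" where
  "H_program =
    [Q_block 0 [(32, 111), (24, 109), (16, 74)], Cross 2, Q_block 0 [(104, 110), (96, 111), (88,
     38)], Cross 1, Vertex 0 32 108, Close 0 7, Cross 5, Q_block 0 [(68, 109), (60, 110), (52,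
     2)], Close 2 14, Cross 12, Vertex 0 68 108, Close 0 3, Cross 4, Vertex 0 104 108, Close 0
     13, Cross 4, Vertex 0 110 111, Close 0 4, Close 1 14]"

text \<open>As with \<open>extend_all\<close>, the recursive call becomes visible only for a
  concrete choice of darts.\<close>

definition run_all :: "instr list \<Rightarrow> dart list \<Rightarrow> dart list list \<Rightarrow> dart list list" where
  "run_all ps env dss = concat (map (\<lambda>ds. run ps (ds @ env)) dss)"

lemma run_rules:
  "run [] env = [env]"
  "run (p # ps) env = run_all ps env (gen p env)"
  "run_all ps env [] = []"
  "run_all ps env (ds # dss) = run ps (ds @ env) @ run_all ps env dss"
  by (simp_all add: run_all_def)

lemma other_colors_table: "map other_colors
    [(0, 1, 2), (0, 1, 3), (0, 1, 4), (0, 2, 3), (0, 2, 4), (0, 3, 4), (1, 0, 2), (1, 0, 3), (1,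
     0, 4), (1, 2, 3), (1, 2, 4), (1, 3, 4), (2, 0, 1), (2, 0, 3), (2, 0, 4), (2, 1, 3), (2, 1,
     4), (2, 3, 4), (3, 0, 1), (3, 0, 2), (3, 0, 4), (3, 1, 2), (3, 1, 4), (3, 2, 4), (4, 0, 1),
     (4, 0, 2), (4, 0, 3), (4, 1, 2), (4, 1, 3), (4, 2, 3)] =
    [[3, 4], [2, 4], [2, 3], [1, 4], [1, 3], [1, 2], [3, 4], [2, 4], [2, 3], [0, 4], [0, 3], [0,
     2], [3, 4], [1, 4], [1, 3], [0, 4], [0, 3], [0, 1], [2, 4], [1, 4], [1, 2], [0, 4], [0, 2],
     [0, 1], [2, 3], [1, 3], [1, 2], [0, 3], [0, 2], [0, 1]]"
  by (simp add: upt_rec)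

lemma mk_dart_table: "map (\<lambda>(a, b). mk_dart k a b)
    [(0, 1), (0, 2), (0, 3), (0, 4), (1, 0), (1, 2), (1, 3), (1, 4), (2, 0), (2, 1), (2, 3), (2,
     4), (3, 0), (3, 1), (3, 2), (3, 4), (4, 0), (4, 1), (4, 2), (4, 3)] =
    [(k, 0, 1), (k, 0, 2), (k, 0, 3), (k, 0, 4), (k, 0, 1), (k, 1, 2), (k, 1, 3), (k, 1, 4), (k,
     0, 2), (k, 1, 2), (k, 2, 3), (k, 2, 4), (k, 0, 3), (k, 1, 3), (k, 2, 3), (k, 3, 4), (k, 0,
     4), (k, 1, 4), (k, 2, 4), (k, 3, 4)]"
  by (simp add: mk_dart_def)

lemmas other_colors_simps = other_colors_table [simplified list.map list.inject simp_thms]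
lemmas mk_dart_simps = mk_dart_table [simplified list.map prod.case list.inject simp_thms]

definition rows :: "dart list list \<Rightarrow> nat list \<Rightarrow> dart list list" where
  "rows T \<sigma> = map (map (recolor \<sigma>)) T"

lemma block_gen_rows: "block_gen T (k, a, b) = rows T (k # a # b # other_colors (k, a, b))"
  by (simp add: block_gen_def rows_def)

text \<open>The table is expanded once for a symbolic permutation, so applying a block to a dart
  costs a single rewrite; \<open>folded\<close> restores the table's name on the left.\<close>

lemmas P_rows = rows_def [of P_table "[k, a, b, d, e]", unfolded P_table_def list.map recolor.simps
  nth_Cons_rules pred_numeral_simps BitM.simps, folded P_table_def] for k a b d e

lemmas Q_rows = rows_def [of Q_table "[k, a, b, d, e]", unfolded Q_table_def list.map recolor.simps
  nth_Cons_rules pred_numeral_simps BitM.simps, folded Q_table_def] for k a b d e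

lemmas less_rules = numeral_less_iff less_num_simps le_num_simps zero_less_numeral zero_less_one one_less_numeral_iff
  not_numeral_less_one not_one_less_zero

lemmas gen_rules = gen.simps vertex_gen.simps cross_gen_def block_gen_rows P_rows Q_rows
  other_colors_simps mk_dart_simps if_True if_False fst_conv prod.inject list.inject list.distinct

lemmas fits_rules = fits.simps fits1.simps new_names.simps fst_conv snd_conv distinct.simps map_prod_simp list.map
  length_less less_rules prod.inject list.inject list.distinct

text \<open>Unary indices make the lookups in the environment cheap.\<close>

lemmas unary = numeral_eq_Suc pred_numeral_simps BitM.simps One_nat_def
lemmas P_program_unary = P_program_def [simplified unary]
lemmas Q_program_unary = Q_program_def [simplified unary]
lemmas H_program_unary = H_program_def [simplified unary]

lemma P_fits: "list_all (\<lambda>h. fits [] [] ((!) h) P_program [(0, 8)]) P_maps"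
  by (simp only: P_maps_def P_program_def fits_rules eval_rules adj_H_simps)

text \<open>In the final environment the positions 16, 7 and 1 hold the darts \<open>(2, 9)\<close>,
  \<open>(3, 10)\<close> and \<open>(4, 11)\<close>, as listed in \<open>P_names\<close>.\<close>

lemma P_run:
  "list_all (\<lambda>env. map ((!) env) [16, 7, 1] \<in> set P_table) (run P_program [(0, 1, 2)])"
  by (simp only: P_program_unary nth_Cons_Suc run_rules gen_rules eval_rules list.map P_table_def)

lemma P_names:
  "run_names P_program [(0, 8)] = 
     [(4, 7), (4, 11), (4, 6), (6, 3), (6, 4), (6, 1), (3, 6), (3, 10), (3, 5), (7, 4), (7, 5),
      (7, 2), (5, 3), (5, 7), (5, 0), (2, 7), (2, 9), (2, 1), (1, 2), (1, 6), (1, 0), (0, 1),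
      (0, 5), (0, 8)]"
  by (simp only: P_program_def run_names.simps fits_rules eval_rules)

lemma established_P: "normal_H c \<Longrightarrow> established c P_table P_sites"
  unfolding established_def
proof (clarify)
  fix u v ns assume c: "normal_H c" and site: "((u, v), ns) \<in> set P_sites"
  then obtain h where h: "h \<in> set P_maps" "(u, v) = (h ! 0, h ! 8)"
      "ns = [(h ! 2, h ! 9), (h ! 3, h ! 10), (h ! 4, h ! 11)]"
    by (auto simp: P_sites_def)
  have names: "list_all (\<lambda>h. list_all (\<lambda>(u, v). h ! u < 112 \<and> h ! v \<in> set (adj_H (h ! u)))
      [(0, 8), (2, 9), (3, 10), (4, 11)]) P_maps"
    by (simp only: P_maps_def fits_rules eval_rules adj_H_simps prod.case)
  have "map (dart c) (map (map_prod ((!) h) ((!) h)) [(2, 9), (3, 10), (4, 11)])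
    \<in> set (block_gen P_table (dart c (map_prod ((!) h) ((!) h) (0, 8))))"
  proof (rule established_by_run [where P = "[]" and R = "[]", OF _ _ c _ P_run])
    show "fits [] [] ((!) h) P_program [(0, 8)]" using P_fits h(1) by (simp add: list_all_iff)
    show "list_all (\<lambda>(u, v). h ! u < 112 \<and> h ! v \<in> set (adj_H (h ! u))) ((0, 8) # [(2, 9), (3, 10), (4, 11)])"
      using names h(1) by (simp add: list_all_iff del: One_nat_def)
  qed (simp_all add: established_def P_names)
  then show "map (dart c) ns \<in> set (block_gen P_table (dart c (u, v)))"
    using h(2,3) by simp
qed

lemma Q_fits: "list_all (\<lambda>h. fits P_sites [] ((!) h) Q_program [(2, 36)]) Q_maps"
  by (simp only: Q_maps_def Q_program_def P_sites_def P_maps_def fits_rules eval_rules adj_H_simps)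

lemma Q_run:
  "list_all (\<lambda>env. map ((!) env) [21, 8, 1] \<in> set Q_table) (run Q_program [(0, 1, 2)])"
  by (simp only: Q_program_unary nth_Cons_Suc run_rules gen_rules eval_rules list.map Q_table_def)

lemma Q_names:
  "map ((!) (run_names Q_program [(2, 36)])) [21, 8, 1] = [(32, 37), (24, 38), (16, 39)]"
  "list_all (\<lambda>i. i < length (run_names Q_program [(2, 36)])) [21, 8, 1]"
  by (simp_all only: Q_program_def run_names.simps fits_rules eval_rules)

lemma established_Q: "normal_H c \<Longrightarrow> established c Q_table Q_sites"
  unfolding established_def
proof (clarify)
  fix u v ns assume c: "normal_H c" and site: "((u, v), ns) \<in> set Q_sites"
  then obtain h where h: "h \<in> set Q_maps" "(u, v) = (h ! 2, h ! 36)"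
      "ns = [(h ! 32, h ! 37), (h ! 24, h ! 38), (h ! 16, h ! 39)]"
    by (auto simp: Q_sites_def)
  have names: "list_all (\<lambda>h. list_all (\<lambda>(u, v). h ! u < 112 \<and> h ! v \<in> set (adj_H (h ! u)))
      [(2, 36), (32, 37), (24, 38), (16, 39)]) Q_maps"
    by (simp only: Q_maps_def fits_rules eval_rules adj_H_simps prod.case)
  have "map (dart c) (map (map_prod ((!) h) ((!) h)) [(32, 37), (24, 38), (16, 39)])
    \<in> set (block_gen Q_table (dart c (map_prod ((!) h) ((!) h) (2, 36))))"
  proof (rule established_by_run [where P = P_sites and R = "[]", OF established_P _ c _ Q_run])
    show "fits P_sites [] ((!) h) Q_program [(2, 36)]" using Q_fits h(1) by (simp add: list_all_iff)
    show "list_all (\<lambda>(u, v). h ! u < 112 \<and> h ! v \<in> set (adj_H (h ! u))) ((2, 36) # [(32, 37), (24, 38), (16, 39)])"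
      using names h(1) by (simp add: list_all_iff)
  qed (simp_all only: established_def Q_names list.set ball_empty)
  then show "map (dart c) ns \<in> set (block_gen Q_table (dart c (u, v)))"
    using h(2,3) by simp
qed

lemma H_fits: "fits P_sites Q_sites (\<lambda>v. v) H_program [(2, 52)]"
  by (simp only: H_program_def Q_sites_def Q_maps_def fits_rules eval_rules adj_H_simps)

lemma H_run: "run H_program [(0, 1, 2)] = []"
  by (simp only: H_program_unary nth_Cons_Suc run_rules gen_rules eval_rules list.map)

lemma no_normal_coloring_H: "\<not> normal_H c"
proof
  assume c: "normal_H c"
  \<comment> \<open>No run survives, so even the empty table is established, for the empty list of
    darts; membership in it is absurd.\<close>
  have "map (dart c) (map (map_prod (\<lambda>v. v) (\<lambda>v. v)) []) \<in> set (block_gen [] (dart c (map_prod (\<lambda>v. v) (\<lambda>v. v) (2, 52))))"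
    by (rule established_by_run [OF established_P established_Q c H_fits])
      (simp_all add: H_run adj_H_simps del: One_nat_def)
  then show False by (simp add: block_gen_def)
qed

section \<open>From Petersen colorings to normal colorings\<close>

definition missing_color :: "nat set set \<Rightarrow> nat" where
  "missing_color E = (THE x. {0..4} - \<Union>E = {x})"

lemma missing_color:
  assumes "A \<subseteq> {0..4}" "card A = 2" "B \<subseteq> {0..4}" "card B = 2" "A \<inter> B = {}"
  shows "{0..4} - (A \<union> B) = {missing_color {A, B}}"
proof -
  have "card ({0..4} - (A \<union> B)) = 1"
    using assms finite_subset [OF assms(1)] finite_subset [OF assms(3)]
    by (simp add: card_Diff_subset card_Un_disjoint)
  then obtain x where "{0..4} - (A \<union> B) = {x}" by (auto simp: card_1_singleton_iff)
  then show ?thesis by (simp add: missing_color_def)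
qed

lemma incident_petersen:
  assumes "A \<in> verts petersen_graph"
  shows "incident petersen_graph A =
    {{A, B} |B. B \<subseteq> {0..4} \<and> card B = 2 \<and> A \<inter> B = {}}"
proof (intro equalityI subsetI)
  fix e assume "e \<in> incident petersen_graph A"
  then obtain P R where e: "e = {P, R}" "P \<subseteq> {0..4}" "card P = 2" "R \<subseteq> {0..4}" "card R = 2"
      "P \<inter> R = {}" and "A = P \<or> A = R"
    by (auto simp: incident_def petersen_graph_def)
  from this(7) show "e \<in> {{A, B} |B. B \<subseteq> {0..4} \<and> card B = 2 \<and> A \<inter> B = {}}"
  proof
    assume "A = P"
    with e show ?thesis by blast
  next
    assume "A = R"
    with e have "e = {A, P}" "A \<inter> P = {}" by auto
    with e show ?thesis by blast
  qed
next
  fix e assume "e \<in> {{A, B} |B. B \<subseteq> {0..4} \<and> card B = 2 \<and> A \<inter> B = {}}"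
  then obtain B where "e = {A, B}" "B \<subseteq> {0..4}" "card B = 2" "A \<inter> B = {}" by blast
  moreover have "A \<subseteq> {0..4}" "card A = 2" using assms by (auto simp: petersen_graph_def)
  ultimately show "e \<in> incident petersen_graph A"
    unfolding incident_def petersen_graph_def by auto
qed

text \<open>A neighbour \<open>B\<close> of \<open>A\<close> is recovered as the complement of
  \<open>A\<close> without the missing color, so the three edges at \<open>A\<close> correspond to
  the three elements outside \<open>A\<close>.\<close>

lemma missing_color_incident:
  assumes A: "A \<in> verts petersen_graph"
  shows "inj_on missing_color (incident petersen_graph A)"
    and "missing_color ` incident petersen_graph A = {0..4} - A"
proof -
  have A': "A \<subseteq> {0..4}" "card A = 2" using A by (auto simp: petersen_graph_def)
  have B_eq: "B = {0..4} - A - {missing_color {A, B}}"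
    if "B \<subseteq> {0..4}" "card B = 2" "A \<inter> B = {}" for B
    using missing_color [OF A' that] that by blast
  show "inj_on missing_color (incident petersen_graph A)"
    unfolding incident_petersen [OF A] using B_eq by (intro inj_onI) (auto, metis+)
  show "missing_color ` incident petersen_graph A = {0..4} - A"
  proof (intro equalityI subsetI)
    fix x assume "x \<in> missing_color ` incident petersen_graph A"
    then show "x \<in> {0..4} - A"
    proof -
      obtain B where B: "B \<subseteq> {0..4}" "card B = 2" "A \<inter> B = {}" "x = missing_color {A, B}"
        using \<open>x \<in> missing_color ` incident petersen_graph A\<close> unfolding incident_petersen [OF A] by blast
      have "x \<in> {0..4} - (A \<union> B)" using missing_color [OF A' B(1-3)] B(4) by simp
      then show ?thesis by simp
    qed
  next
    fix x assume x: "x \<in> {0..4} - A"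
    define B where "B = {0..4} - A - {x}"
    have B: "B \<subseteq> {0..4}" "card B = 2" "A \<inter> B = {}"
      using x A' finite_subset [OF A'(1)] by (auto simp: B_def card_Diff_subset)
    then have "missing_color {A, B} = x" using missing_color [OF A' B] x by (auto simp: B_def)
    moreover have "{A, B} \<in> incident petersen_graph A"
      unfolding incident_petersen [OF A] using B by blast
    ultimately show "x \<in> missing_color ` incident petersen_graph A" by blast
  qed
qed

text \<open>The vertices assigned to the two ends of an edge lie on a common edge of the Petersen
  graph, so they are equal or disjoint pairs. Equal pairs give the three colors outside that pair;
  for disjoint pairs the two complements cover all five colors.\<close>

lemma petersen_coloring_normal:
  assumes "is_petersen_coloring G \<phi>" "\<And>e. e \<in> edges G \<Longrightarrow> e \<subseteq> verts G"
  shows "normal_5_edge_coloring G (missing_color \<circ> \<phi>)"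
proof -
  let ?c = "missing_color \<circ> \<phi>"
  have "\<exists>A. A \<in> verts petersen_graph \<and> bij_betw \<phi> (incident G v) (incident petersen_graph A)"
    if "v \<in> verts G" for v
    using assms(1) that by (auto simp: is_petersen_coloring_def is_H_coloring_def)
  then obtain A where A: "\<And>v. v \<in> verts G \<Longrightarrow> A v \<in> verts petersen_graph"
      "\<And>v. v \<in> verts G \<Longrightarrow> bij_betw \<phi> (incident G v) (incident petersen_graph (A v))"
    by metis
  have inj: "inj_on ?c (incident G v)" if "v \<in> verts G" for v
    using A [OF that] missing_color_incident(1) by (auto simp: bij_betw_def intro: comp_inj_on)
  have image: "?c ` incident G v = {0..4} - A v" if "v \<in> verts G" for v
    unfolding image_comp [symmetric]
    using A [OF that] missing_color_incident(2) by (simp add: bij_betw_def)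
  have A_card: "A v \<subseteq> {0..4}" "card (A v) = 2" if "v \<in> verts G" for v
    using A(1) [OF that] by (auto simp: petersen_graph_def)
  have "?c e < 5" if "e \<in> edges G" for e
  proof -
    have "\<phi> e \<in> edges petersen_graph"
      using assms(1) that by (auto simp: is_petersen_coloring_def is_H_coloring_def)
    then obtain B C where e: "\<phi> e = {B, C}" and BC: "B \<subseteq> {0..4}" "card B = 2" "C \<subseteq> {0..4}" "card C = 2" "B \<inter> C = {}"
      by (auto simp: petersen_graph_def)
    have "missing_color {B, C} \<in> {0..4} - (B \<union> C)" unfolding missing_color [OF BC] by simp
    then show ?thesis by (simp add: e)
  qed
  moreover have "?c e \<noteq> ?c f" if ef: "e \<in> edges G" "f \<in> edges G" "e \<noteq> f" "e \<inter> f \<noteq> {}" for e f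
  proof -
    obtain v where v: "v \<in> e" "v \<in> f" using ef by blast
    then have "v \<in> verts G" "e \<in> incident G v" "f \<in> incident G v"
      using ef assms(2) by (auto simp: incident_def)
    then show ?thesis using inj ef(3) by (meson inj_onD)
  qed
  moreover have "card (?c ` (incident G u \<union> incident G v)) \<in> {3, 5}" if uv: "{u, v} \<in> edges G" for u v
  proof -
    have V: "u \<in> verts G" "v \<in> verts G" using assms(2) [OF uv] by auto
    have "{u, v} \<in> incident G u" "{u, v} \<in> incident G v" using uv by (auto simp: incident_def)
    then have "\<phi> {u, v} \<in> incident petersen_graph (A u)" "\<phi> {u, v} \<in> incident petersen_graph (A v)"
      using A(2) V by (auto simp: bij_betw_def)
    then have "A u = A v \<or> A u \<inter> A v = {}"
      unfolding incident_petersen [OF A(1) [OF V(1)]] incident_petersen [OF A(1) [OF V(2)]]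
      by (auto simp: doubleton_eq_iff)
    then show ?thesis
    proof
      assume "A u = A v"
      then have "?c ` (incident G u \<union> incident G v) = {0..4} - A u"
        using image V by (simp add: image_Un)
      then show ?thesis
        using A_card [OF V(1)] finite_subset [OF A_card(1) [OF V(1)]] by (simp add: card_Diff_subset)
    next
      assume "A u \<inter> A v = {}"
      then have "?c ` (incident G u \<union> incident G v) = {0..4}"
        unfolding image_Un image [OF V(1)] image [OF V(2)] by auto
      then show ?thesis by simp
    qed
  qed
  ultimately show ?thesis
    unfolding normal_5_edge_coloring_def proper_edge_coloring_def by blast
qed

section \<open>The digest\<close>

text \<open>The list begins with the least significant bit.\<close>

definition bits :: "bool list \<Rightarrow> 'a::len word" where
  "bits bs = horner_sum of_bool 2 bs"

lemma bit_bits: "bit (bits bs :: 'a::len word) i \<longleftrightarrow> i < LENGTH('a) \<and> i < length bs \<and> bs ! i"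
  by (simp add: bits_def bit_horner_sum_bit_word_iff)

definition bitwise :: "(bool \<Rightarrow> bool \<Rightarrow> bool \<Rightarrow> bool) \<Rightarrow> bool list \<Rightarrow> bool list \<Rightarrow> bool list \<Rightarrow> bool list" where
  "bitwise f xs ys zs = map2 (\<lambda>x (y, z). f x y z) xs (zip ys zs)"

lemma bitwise_simps:
  "bitwise f (x # xs) (y # ys) (z # zs) = f x y z # bitwise f xs ys zs"
  "bitwise f [] [] [] = []"
  by (simp_all add: bitwise_def)

definition xor3 :: "bool \<Rightarrow> bool \<Rightarrow> bool \<Rightarrow> bool" where "xor3 x y z = (x = (y = z))"
definition mux :: "bool \<Rightarrow> bool \<Rightarrow> bool \<Rightarrow> bool" where "mux x y z = (if x then y else z)"
definition majority :: "bool \<Rightarrow> bool \<Rightarrow> bool \<Rightarrow> bool" where "majority x y z = (if x then y \<or> z else y \<and> z)"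

fun add_bits :: "bool list \<Rightarrow> bool list \<Rightarrow> bool \<Rightarrow> bool list" where
  "add_bits (x # xs) (y # ys) c = xor3 x y c # add_bits xs ys (majority x y c)"
| "add_bits _ _ _ = []"

text \<open>Ripple-carry addition; the overflow is absorbed in the multiple \<open>k\<close> of a
  power of two. In a general commutative ring nothing has to be said about its size, and for
  \<open>32 word\<close> the factor \<open>2 ^ 32\<close> is zero.\<close>

lemma add_bits_value:
  assumes "length xs = length ys"
  shows "\<exists>k. horner_sum of_bool 2 xs + horner_sum of_bool 2 ys + of_bool c =
    (horner_sum of_bool 2 (add_bits xs ys c) + 2 ^ length xs * k :: 'a::comm_ring_1)"
  using assms
proof (induction xs ys arbitrary: c rule: list_induct2)
  case (Cons x xs y ys)
  obtain k where "horner_sum of_bool 2 xs + horner_sum of_bool 2 ys + of_bool (majority x y c) =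
    (horner_sum of_bool 2 (add_bits xs ys (majority x y c)) + 2 ^ length xs * k :: 'a)"
    using Cons.IH by blast
  then have k: "2 * horner_sum of_bool 2 xs + 2 * horner_sum of_bool 2 ys + 2 * of_bool (majority x y c) =
    (2 * horner_sum of_bool 2 (add_bits xs ys (majority x y c)) + 2 * (2 ^ length xs * k) :: 'a)"
    by (metis distrib_left)
  have digit: "of_bool x + of_bool y + of_bool c =
      (of_bool (xor3 x y c) + 2 * of_bool (majority x y c) :: 'a)"
    by (simp add: xor3_def majority_def)
  have "horner_sum of_bool 2 (x # xs) + horner_sum of_bool 2 (y # ys) + of_bool c =
      (of_bool x + of_bool y + of_bool c) +
      (2 * horner_sum of_bool 2 xs + 2 * horner_sum of_bool 2 ys :: 'a)"
    by (simp add: ac_simps)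
  also have "\<dots> = of_bool (xor3 x y c) + (2 * horner_sum of_bool 2 xs +
      2 * horner_sum of_bool 2 ys + 2 * of_bool (majority x y c))"
    unfolding digit by (simp only: ac_simps)
  also have "\<dots> = horner_sum of_bool 2 (add_bits (x # xs) (y # ys) c) + 2 ^ length (x # xs) * k"
    by (simp only: k) (simp add: ac_simps)
  finally show ?case by blast
qed (auto intro: exI [of _ "of_bool c"])

text \<open>The second argument prescribes the length: its tail supplies the leading zeros, and
  digits beyond its end are dropped.\<close>

fun pad_num :: "num \<Rightarrow> bool list \<Rightarrow> bool list" where
  "pad_num num.One (z # zs) = True # zs"
| "pad_num (num.Bit0 n) (z # zs) = False # pad_num n zs"
| "pad_num (num.Bit1 n) (z # zs) = True # pad_num n zs"
| "pad_num n [] = []"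

lemma pad_num_value:
  "\<exists>k. (numeral n :: 'a::comm_ring_1) =
    horner_sum of_bool 2 (pad_num n (replicate m False)) + 2 ^ m * k"
proof (induction n arbitrary: m)
  case One
  show ?case
  proof (cases m)
    case (Suc m')
    have "horner_sum of_bool 2 (replicate m' False) = (0 :: 'a)" by (induction m') simp_all
    then show ?thesis using Suc by (auto intro: exI [of _ 0])
  qed simp
next
  case (Bit0 n)
  show ?case
  proof (cases m)
    case (Suc m')
    obtain k where k: "(numeral n :: 'a) =
        horner_sum of_bool 2 (pad_num n (replicate m' False)) + 2 ^ m' * k"
      using Bit0.IH by blast
    have "(numeral (num.Bit0 n) :: 'a) =
        2 * horner_sum of_bool 2 (pad_num n (replicate m' False)) + 2 ^ m * k"
      by (subst numeral_Bit0_eq_double, subst k) (simp add: Suc algebra_simps)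
    then show ?thesis using Suc by auto
  qed simp
next
  case (Bit1 n)
  show ?case
  proof (cases m)
    case (Suc m')
    obtain k where k: "(numeral n :: 'a) =
        horner_sum of_bool 2 (pad_num n (replicate m' False)) + 2 ^ m' * k"
      using Bit1.IH by blast
    have "(numeral (num.Bit1 n) :: 'a) =
        1 + 2 * horner_sum of_bool 2 (pad_num n (replicate m' False)) + 2 ^ m * k"
      by (subst numeral_Bit1_eq_inc_double, subst k) (simp add: Suc algebra_simps)
    then show ?thesis using Suc by auto
  qed simp
qed

context
  includes bit_operations_syntax
begin

lemma bits_plus:
  assumes "length xs = 32" "length ys = 32"
  shows "(bits xs + bits ys :: 32 word) = bits (add_bits xs ys False)"
proof -
  have "(2 ^ 32 :: 32 word) = 0" by simp
  with add_bits_value [of xs ys False, where ?'a = "32 word"] assms show ?thesis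
    by (simp only: bits_def of_bool_eq add_0_right mult_zero_left simp_thms)
qed

lemma numeral_bits: "(numeral n :: 32 word) = bits (pad_num n (replicate 32 False))"
proof -
  have "(2 ^ 32 :: 32 word) = 0" by simp
  with pad_num_value [of n 32, where ?'a = "32 word"] show ?thesis
    by (simp only: bits_def add_0_right mult_zero_left simp_thms)
qed

lemma word_rotr_bits:
  assumes "length xs = 32" "n < 32"
  shows "word_rotr n (bits xs :: 32 word) = bits (drop n xs @ take n xs)"
proof (rule bit_word_eqI)
  fix i assume i: "i < LENGTH(32)"
  then have "(i + n) mod 32 = (if i < 32 - n then i + n else i - (32 - n))"
    using assms by (auto simp: mod_if)
  then show "bit (word_rotr n (bits xs :: 32 word)) i \<longleftrightarrow> bit (bits (drop n xs @ take n xs) :: 32 word) i"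
    using assms i by (auto simp: bit_bits bit_word_rotr_iff nth_append add.commute)
qed

lemma drop_bit_bits:
  assumes "length xs = 32" "n \<le> 32"
  shows "drop_bit n (bits xs :: 32 word) = bits (drop n xs @ replicate n False)"
  using assms by (intro bit_word_eqI) (auto simp: bit_bits bit_drop_bit_eq nth_append add.commute)

lemma xor3_bits:
  assumes "length xs = 32" "length ys = 32" "length zs = 32"
  shows "(bits xs XOR bits ys XOR bits zs :: 32 word) = bits (bitwise xor3 xs ys zs)"
  using assms
  by (intro bit_word_eqI) (auto simp: bit_bits bit_xor_iff bitwise_def xor3_def)

lemma Sigma0_bits:
  assumes "length xs = 32"
  shows "sha_Sigma0 (bits xs) =
    bits (bitwise xor3 (drop 2 xs @ take 2 xs) (drop 13 xs @ take 13 xs)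
      (drop 22 xs @ take 22 xs))"
  using assms by (simp add: sha_Sigma0_def word_rotr_bits xor3_bits)

lemma Sigma1_bits:
  assumes "length xs = 32"
  shows "sha_Sigma1 (bits xs) =
    bits (bitwise xor3 (drop 6 xs @ take 6 xs) (drop 11 xs @ take 11 xs)
      (drop 25 xs @ take 25 xs))"
  using assms by (simp add: sha_Sigma1_def word_rotr_bits xor3_bits)

lemma sigma0_bits:
  assumes "length xs = 32"
  shows "sha_sigma0 (bits xs) =
    bits (bitwise xor3 (drop 7 xs @ take 7 xs) (drop 18 xs @ take 18 xs)
      (drop 3 xs @ replicate 3 False))"
  using assms by (simp add: sha_sigma0_def word_rotr_bits drop_bit_bits xor3_bits)

lemma sigma1_bits:
  assumes "length xs = 32"
  shows "sha_sigma1 (bits xs) =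
    bits (bitwise xor3 (drop 17 xs @ take 17 xs) (drop 19 xs @ take 19 xs)
      (drop 10 xs @ replicate 10 False))"
  using assms by (simp add: sha_sigma1_def word_rotr_bits drop_bit_bits xor3_bits)

lemma Ch_bits:
  assumes "length xs = 32" "length ys = 32" "length zs = 32"
  shows "sha_Ch (bits xs) (bits ys) (bits zs) = bits (bitwise mux xs ys zs)"
  using assms unfolding sha_Ch_def
  by (intro bit_word_eqI)
    (auto simp: bit_bits bit_xor_iff bit_and_iff bit_not_iff bitwise_def mux_def)

lemma Maj_bits:
  assumes "length xs = 32" "length ys = 32" "length zs = 32"
  shows "sha_Maj (bits xs) (bits ys) (bits zs) = bits (bitwise majority xs ys zs)"
  using assms unfolding sha_Maj_def
  by (intro bit_word_eqI)
    (auto simp: bit_bits bit_xor_iff bit_and_iff bitwise_def majority_def)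

end

lemma replicate_False:
  "replicate 3 False = [False, False, False]"
  "replicate 10 False = [False, False, False, False, False, False, False, False, False, False]"
  "replicate 32 False =
    [False, False, False, False, False, False, False, False, False, False, False, False, False, False, False, False, False, False, False, False, False, False, False, False, False, False, False, False, False, False, False, False]"
  by (simp_all add: numeral_eq_Suc)

text \<open>For explicit lists of 32 bits, the rules become unconditional, and the hash can be computed by rewriting.\<close>

lemma bits_plus_32:
  "(bits [x0, x1, x2, x3, x4, x5, x6, x7, x8, x9, x10, x11, x12, x13, x14, x15, x16, x17, x18,
    x19, x20, x21, x22, x23, x24, x25, x26, x27, x28, x29, x30, x31] + bits [y0, y1, y2, y3, y4,
    y5, y6, y7, y8, y9, y10, y11, y12, y13, y14, y15, y16, y17, y18, y19, y20, y21, y22, y23,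
    y24, y25, y26, y27, y28, y29, y30, y31] :: 32 word) = bits (add_bits [x0, x1, x2, x3, x4,
    x5, x6, x7, x8, x9, x10, x11, x12, x13, x14, x15, x16, x17, x18, x19, x20, x21, x22, x23,
    x24, x25, x26, x27, x28, x29, x30, x31] [y0, y1, y2, y3, y4, y5, y6, y7, y8, y9, y10, y11,
    y12, y13, y14, y15, y16, y17, y18, y19, y20, y21, y22, y23, y24, y25, y26, y27, y28, y29,
    y30, y31] False)"
  by (rule bits_plus) simp_all

lemmas Sigma0_bits_32 = Sigma0_bits
  [of "[x0, x1, x2, x3, x4, x5, x6, x7, x8, x9, x10, x11, x12, x13, x14, x15, x16, x17, x18,
    x19, x20, x21, x22, x23, x24, x25, x26, x27, x28, x29, x30, x31]", simplified]
  for x0 x1 x2 x3 x4 x5 x6 x7 x8 x9 x10 x11 x12 x13 x14 x15 x16 x17 x18 x19 x20 x21 x22 x23 x24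
    x25 x26 x27 x28 x29 x30 x31
lemmas Sigma1_bits_32 = Sigma1_bits
  [of "[x0, x1, x2, x3, x4, x5, x6, x7, x8, x9, x10, x11, x12, x13, x14, x15, x16, x17, x18,
    x19, x20, x21, x22, x23, x24, x25, x26, x27, x28, x29, x30, x31]", simplified]
  for x0 x1 x2 x3 x4 x5 x6 x7 x8 x9 x10 x11 x12 x13 x14 x15 x16 x17 x18 x19 x20 x21 x22 x23 x24
    x25 x26 x27 x28 x29 x30 x31
lemmas sigma0_bits_32 = sigma0_bits
  [of "[x0, x1, x2, x3, x4, x5, x6, x7, x8, x9, x10, x11, x12, x13, x14, x15, x16, x17, x18,
    x19, x20, x21, x22, x23, x24, x25, x26, x27, x28, x29, x30, x31]", simplified, unfolded replicate_False append.simps]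
  for x0 x1 x2 x3 x4 x5 x6 x7 x8 x9 x10 x11 x12 x13 x14 x15 x16 x17 x18 x19 x20 x21 x22 x23 x24
    x25 x26 x27 x28 x29 x30 x31
lemmas sigma1_bits_32 = sigma1_bits
  [of "[x0, x1, x2, x3, x4, x5, x6, x7, x8, x9, x10, x11, x12, x13, x14, x15, x16, x17, x18,
    x19, x20, x21, x22, x23, x24, x25, x26, x27, x28, x29, x30, x31]", simplified, unfolded replicate_False append.simps]
  for x0 x1 x2 x3 x4 x5 x6 x7 x8 x9 x10 x11 x12 x13 x14 x15 x16 x17 x18 x19 x20 x21 x22 x23 x24
    x25 x26 x27 x28 x29 x30 x31
lemmas Ch_bits_32 = Ch_bits
  [of "[x0, x1, x2, x3, x4, x5, x6, x7, x8, x9, x10, x11, x12, x13, x14, x15, x16, x17, x18,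
    x19, x20, x21, x22, x23, x24, x25, x26, x27, x28, x29, x30, x31]" "[y0, y1, y2, y3, y4, y5,
    y6, y7, y8, y9, y10, y11, y12, y13, y14, y15, y16, y17, y18, y19, y20, y21, y22, y23, y24,
    y25, y26, y27, y28, y29, y30, y31]" "[z0, z1, z2, z3, z4, z5, z6, z7, z8, z9, z10, z11, z12,
    z13, z14, z15, z16, z17, z18, z19, z20, z21, z22, z23, z24, z25, z26, z27, z28, z29, z30,
    z31]", simplified]
  for x0 x1 x2 x3 x4 x5 x6 x7 x8 x9 x10 x11 x12 x13 x14 x15 x16 x17 x18 x19 x20 x21 x22 x23 x24
    x25 x26 x27 x28 x29 x30 x31 y0 y1 y2 y3 y4 y5 y6 y7 y8 y9 y10 y11 y12 y13 y14 y15 y16 y17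
    y18 y19 y20 y21 y22 y23 y24 y25 y26 y27 y28 y29 y30 y31 z0 z1 z2 z3 z4 z5 z6 z7 z8 z9 z10
    z11 z12 z13 z14 z15 z16 z17 z18 z19 z20 z21 z22 z23 z24 z25 z26 z27 z28 z29 z30 z31
lemmas Maj_bits_32 = Maj_bits
  [of "[x0, x1, x2, x3, x4, x5, x6, x7, x8, x9, x10, x11, x12, x13, x14, x15, x16, x17, x18,
    x19, x20, x21, x22, x23, x24, x25, x26, x27, x28, x29, x30, x31]" "[y0, y1, y2, y3, y4, y5,
    y6, y7, y8, y9, y10, y11, y12, y13, y14, y15, y16, y17, y18, y19, y20, y21, y22, y23, y24,
    y25, y26, y27, y28, y29, y30, y31]" "[z0, z1, z2, z3, z4, z5, z6, z7, z8, z9, z10, z11, z12,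
    z13, z14, z15, z16, z17, z18, z19, z20, z21, z22, z23, z24, z25, z26, z27, z28, z29, z30,
    z31]", simplified]
  for x0 x1 x2 x3 x4 x5 x6 x7 x8 x9 x10 x11 x12 x13 x14 x15 x16 x17 x18 x19 x20 x21 x22 x23 x24
    x25 x26 x27 x28 x29 x30 x31 y0 y1 y2 y3 y4 y5 y6 y7 y8 y9 y10 y11 y12 y13 y14 y15 y16 y17
    y18 y19 y20 y21 y22 y23 y24 y25 y26 y27 y28 y29 y30 y31 z0 z1 z2 z3 z4 z5 z6 z7 z8 z9 z10
    z11 z12 z13 z14 z15 z16 z17 z18 z19 z20 z21 z22 z23 z24 z25 z26 z27 z28 z29 z30 z31

lemma zero_bits_replicate: "(0 :: 32 word) = bits (replicate 32 False)"
  by (intro bit_word_eqI) (simp add: bit_bits)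

lemmas zero_bits = zero_bits_replicate [unfolded replicate_False]
lemmas numeral_bits_32 = numeral_bits [unfolded replicate_False]

lemmas sha_K_bits = sha_K_def [simplified numeral_bits_32 pad_num.simps]
lemmas sha_init_bits = sha_init_def [simplified numeral_bits_32 pad_num.simps]

text \<open>\<open>sha_extend\<close> looks back 2, 7, 15 and 16 places in a growing list. In a
  window of the last 16 words these are the fixed indices 14, 9, 1 and 0; 48 words are emitted
  before the final window, making 64.\<close>

fun sliding_schedule :: "nat \<Rightarrow> 32 word list \<Rightarrow> 32 word list" where
  "sliding_schedule 0 ws = ws"
| "sliding_schedule (Suc n) ws = hd ws # sliding_schedule n
     (tl ws @ [sha_sigma1 (ws ! 14) + ws ! 9 + sha_sigma0 (ws ! 1) + ws ! 0])"

lemma funpow_sha_extend: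
  "length ws = 16 \<Longrightarrow> (sha_extend ^^ n) (vs @ ws) = vs @ sliding_schedule n ws"
proof (induction n arbitrary: vs ws)
  case (Suc n)
  obtain w us where ws: "ws = w # us" "length us = 15"
    using Suc.prems by (cases ws) auto
  let ?w = "sha_sigma1 (ws ! 14) + ws ! 9 + sha_sigma0 (ws ! 1) + ws ! 0"
  have "sha_extend (vs @ ws) = (vs @ [w]) @ (us @ [?w])"
    using ws by (simp add: sha_extend_def Let_def nth_append)
  then have "(sha_extend ^^ Suc n) (vs @ ws) = (sha_extend ^^ n) ((vs @ [w]) @ (us @ [?w]))"
    by (simp add: funpow_Suc_right del: funpow.simps)
  also have "\<dots> = (vs @ [w]) @ sliding_schedule n (us @ [?w])"
    using ws by (intro Suc.IH) simp
  finally show ?case using ws by simp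
qed simp

lemma sha_schedule_sliding: "length ws = 16 \<Longrightarrow> sha_schedule ws = sliding_schedule 48 ws"
  using funpow_sha_extend [of ws 48 "[]"] by (simp add: sha_schedule_def)

lemma sha_schedule_16:
  "sha_schedule [w0, w1, w2, w3, w4, w5, w6, w7, w8, w9, w10, w11, w12, w13, w14, w15] =
    sliding_schedule 48 [w0, w1, w2, w3, w4, w5, w6, w7, w8, w9, w10, w11, w12, w13, w14, w15]"
  by (rule sha_schedule_sliding) simp

lemma sliding_schedule_16:
  "sliding_schedule (numeral n) [w0, w1, w2, w3, w4, w5, w6, w7, w8, w9, w10, w11, w12, w13, w14, w15] =
    w0 # sliding_schedule (pred_numeral n) [w1, w2, w3, w4, w5, w6, w7, w8, w9, w10, w11, w12, w13, w14, w15, sha_sigma1 w14 + w9 + sha_sigma0 w1 + w0]"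
  by (simp add: numeral_eq_Suc)

lemma sha_round_8:
  "sha_round (k, w) [a, b, c, d, e, f, g, h] =
    (let t1 = h + sha_Sigma1 e + sha_Ch e f g + k + w;
         t2 = sha_Sigma0 a + sha_Maj a b c
     in [t1 + t2, a, b, c, d + t1, e, f, g])"
  by (simp add: sha_round_def)

lemma sha_compress_fold:
  "sha_compress block s = map2 (+) s (fold sha_round (zip sha_K (sha_schedule block)) s)"
  by (simp add: sha_compress_def)

lemma xor3_simps: "xor3 True y z = (y = z)" "xor3 False y z = (y \<noteq> z)"
  by (auto simp: xor3_def)

lemma of_char_bits: "(of_char (Char a0 a1 a2 a3 a4 a5 a6 a7) :: 8 word) = bits [a0, a1, a2, a3, a4, a5, a6, a7]"
  by (simp add: bits_def of_char_def)

lemma bits_of_int: "(bits bs :: 'a::len word) = word_of_int (horner_sum of_bool 2 bs)"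
  by (induction bs) (simp_all add: bits_def)

lemma uint_bits: "length bs = 8 \<Longrightarrow> uint (bits bs :: 8 word) = horner_sum of_bool 2 bs"
  by (simp add: bits_of_int uint_word_of_int_eq take_bit_horner_sum_bit_eq)

text \<open>Bytes are big-endian while bit lists start with the least significant bit, hence the
  reversed order of the bytes.\<close>

lemma word_rcat_bits:
  assumes "length as = 8" "length bs = 8" "length cs = 8" "length ds = 8"
  shows "word_rcat [bits as :: 8 word, bits bs, bits cs, bits ds] = (bits (ds @ cs @ bs @ as) :: 32 word)"
  using assms
  by (simp add: word_rcat_def uint_bits bits_of_int [of "ds @ cs @ bs @ as"] horner_sum_append algebra_simps)

text \<open>\<open>Char\<close> already carries its bits, least significant first, so no character
  code has to be computed.\<close>

lemma word_rcat_chars: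
  "word_rcat [of_char (Char a0 a1 a2 a3 a4 a5 a6 a7) :: 8 word, of_char (Char b0 b1 b2 b3 b4 b5 b6 b7),
     of_char (Char c0 c1 c2 c3 c4 c5 c6 c7), of_char (Char d0 d1 d2 d3 d4 d5 d6 d7)] =
   (bits [d0, d1, d2, d3, d4, d5, d6, d7,
     c0, c1, c2, c3, c4, c5, c6, c7,
     b0, b1, b2, b3, b4, b5, b6, b7,
     a0, a1, a2, a3, a4, a5, a6, a7] :: 32 word)"
  by (simp only: of_char_bits, subst word_rcat_bits) simp_all

section \<open>The byte string and its hash\<close>

lemma sorted_adj: "sorted (neighbours ps u)"
  by (simp add: neighbours_def)

lemma filter_mem_upt:
  assumes "sorted xs" "distinct xs" "set xs \<subseteq> {..<n}"
  shows "filter (\<lambda>v. v \<in> set xs) [0..<n] = xs"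
  using assms by (intro sorted_distinct_set_unique) (auto intro: sorted_wrt_filter)

text \<open>Instead of testing all pairs of vertices, each vertex contributes its larger neighbours;
  sortedness of \<open>neighbours\<close> yields the lexicographic order.\<close>

lemma sorted_edge_list_H:
  "sorted_edge_list graph_H =
     concat (map (\<lambda>u. map (Pair u) (filter (\<lambda>v. u < v) (adj_H u))) [0..<112])"
proof -
  have "concat (map (\<lambda>v. if u < v \<and> {u, v} \<in> edges graph_H then [(u, v)] else []) [0..<112]) =
      map (Pair u) (filter (\<lambda>v. u < v) (adj_H u))" if "u < 112" for u
  proof -
    have "concat (map (\<lambda>v. if P v then [(u, v)] else []) xs) = map (Pair u) (filter P xs)" for P and xs :: "nat list"
      by (induction xs) auto
    moreover have "filter (\<lambda>v. u < v \<and> v \<in> set (adj_H u)) [0..<112] = filter (\<lambda>v. u < v) (adj_H u)"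
    proof -
      have "filter (\<lambda>v. v \<in> set (adj_H u)) [0..<112] = adj_H u"
        using adj_H_checks adj_H_props(1) that
        by (intro filter_mem_upt) (auto simp: sorted_adj list_all_iff)
      moreover have "filter (\<lambda>v. u < v \<and> v \<in> set (adj_H u)) [0..<112] =
          filter (\<lambda>v. u < v) (filter (\<lambda>v. v \<in> set (adj_H u)) [0..<112])"
        by (simp add: conj_commute)
      ultimately show ?thesis by simp
    qed
    ultimately show ?thesis by (simp add: edge_H_iff)
  qed
  moreover have "sorted_list_of_set {..<112} = [0..<112::nat]"
    by (simp add: lessThan_atLeast0)
  ultimately show ?thesis
    unfolding sorted_edge_list_def verts_H by (auto intro!: arg_cong [where f = concat])
qed

lemma sorted_edge_list_H_eval: "sorted_edge_list graph_H =
    [(0, 1), (0, 5), (0, 31), (1, 2), (1, 6), (2, 7), (2, 52), (3, 5), (3, 6), (3, 11), (4, 6),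
      (4, 7), (4, 9), (5, 7), (8, 9), (8, 10), (8, 11), (9, 14), (10, 12), (10, 20), (11, 28),
      (12, 13), (12, 17), (13, 14), (13, 18), (14, 19), (15, 17), (15, 18), (15, 22), (16, 18),
      (16, 19), (16, 74), (17, 19), (20, 21), (20, 25), (21, 22), (21, 26), (22, 27), (23, 25),
      (23, 26), (23, 30), (24, 26), (24, 27), (24, 109), (25, 27), (28, 29), (28, 33), (29, 30),
      (29, 34), (30, 35), (31, 33), (31, 34), (32, 34), (32, 35), (32, 111), (33, 35), (36, 37),
      (36, 41), (36, 67), (37, 38), (37, 42), (38, 43), (38, 88), (39, 41), (39, 42), (39, 47),
      (40, 42), (40, 43), (40, 45), (41, 43), (44, 45), (44, 46), (44, 47), (45, 50), (46, 48),
      (46, 56), (47, 64), (48, 49), (48, 53), (49, 50), (49, 54), (50, 55), (51, 53), (51, 54),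
      (51, 58), (52, 54), (52, 55), (53, 55), (56, 57), (56, 61), (57, 58), (57, 62), (58, 63),
      (59, 61), (59, 62), (59, 66), (60, 62), (60, 63), (60, 110), (61, 63), (64, 65), (64, 69),
      (65, 66), (65, 70), (66, 71), (67, 69), (67, 70), (68, 70), (68, 71), (68, 109), (69, 71),
      (72, 73), (72, 77), (72, 103), (73, 74), (73, 78), (74, 79), (75, 77), (75, 78), (75, 83),
      (76, 78), (76, 79), (76, 81), (77, 79), (80, 81), (80, 82), (80, 83), (81, 86), (82, 84),
      (82, 92), (83, 100), (84, 85), (84, 89), (85, 86), (85, 90), (86, 91), (87, 89), (87, 90),
      (87, 94), (88, 90), (88, 91), (89, 91), (92, 93), (92, 97), (93, 94), (93, 98), (94, 99),
      (95, 97), (95, 98), (95, 102), (96, 98), (96, 99), (96, 111), (97, 99), (100, 101), (100,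
      105), (101, 102), (101, 106), (102, 107), (103, 105), (103, 106), (104, 106), (104, 107),
      (104, 110), (105, 107), (108, 109), (108, 110), (108, 111)]"
  unfolding sorted_edge_list_H upt_112 by (simp add: adj_H_simps del: One_nat_def)

lemma decimal_table: "map decimal [0..<112] =
    [''0'', ''1'', ''2'', ''3'', ''4'', ''5'', ''6'', ''7'', ''8'', ''9'', ''10'', ''11'',
      ''12'', ''13'', ''14'', ''15'', ''16'', ''17'', ''18'', ''19'', ''20'', ''21'', ''22'',
      ''23'', ''24'', ''25'', ''26'', ''27'', ''28'', ''29'', ''30'', ''31'', ''32'', ''33'',
      ''34'', ''35'', ''36'', ''37'', ''38'', ''39'', ''40'', ''41'', ''42'', ''43'', ''44'',
      ''45'', ''46'', ''47'', ''48'', ''49'', ''50'', ''51'', ''52'', ''53'', ''54'', ''55'',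
      ''56'', ''57'', ''58'', ''59'', ''60'', ''61'', ''62'', ''63'', ''64'', ''65'', ''66'',
      ''67'', ''68'', ''69'', ''70'', ''71'', ''72'', ''73'', ''74'', ''75'', ''76'', ''77'',
      ''78'', ''79'', ''80'', ''81'', ''82'', ''83'', ''84'', ''85'', ''86'', ''87'', ''88'',
      ''89'', ''90'', ''91'', ''92'', ''93'', ''94'', ''95'', ''96'', ''97'', ''98'', ''99'',
      ''100'', ''101'', ''102'', ''103'', ''104'', ''105'', ''106'', ''107'', ''108'', ''109'',
      ''110'', ''111'']"
  by (simp add: upt_112 decimal.simps)

lemmas decimal_simps = decimal_table [simplified upt_112 list.map list.inject simp_thms]

lemmas message_eval = normalized_edge_list_def json_array_def sorted_edge_list_H_eval
  list.map prod.case decimal_simps comma_separated.simps append.simps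

lemma length_rules: "length [] = 0" "length (x # xs) = length xs + 1"
  by simp_all

lemma length_message: "length (normalized_edge_list graph_H) = 1351"
  by (simp only: message_eval length_rules add_0 one_plus_numeral numeral_plus_one numeral_plus_numeral add_num_simps one_add_one
    num.inject numeral_eq_iff)

text \<open>As 1351 is 7 modulo 64, there are (119 - 7) mod 64 = 48 zero bytes, and the bit length
  10808 is 0x2A38; in all 22 blocks. The padding is written with characters so that
  \<open>word_rcat_chars\<close> applies to the whole message.\<close>

lemma sha_pad_message:
  assumes "length s = 1351"
  shows "sha_pad (ascii_bytes s) = map of_char (s @ CHR 0x80 # replicate 48 (CHR 0x00) @
    [CHR 0x00, CHR 0x00, CHR 0x00, CHR 0x00, CHR 0x00, CHR 0x00, CHR 0x2A, CHR 0x38])"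
  using assms
  by (simp add: sha_pad_def ascii_bytes_def big_endian_bytes_def upt_rec)

lemma replicate_48: "replicate 48 x =
    [x, x, x, x, x, x, x, x, x, x, x, x, x, x, x, x, x, x, x, x, x, x, x, x, x, x, x, x, x, x, x,
    x, x, x, x, x, x, x, x, x, x, x, x, x, x, x, x, x]"
  by (simp add: numeral_eq_Suc)

lemma chunks_rules:
  "chunks (numeral n) [] = []"
  "chunks (numeral n) (x # xs) = take (numeral n) (x # xs) # chunks (numeral n) (drop (numeral n) (x # xs))"
  by (simp_all add: chunks.simps)

lemma take_drop_rules:
  "take 0 xs = []" "take (numeral n) (x # xs) = x # take (pred_numeral n) xs"
  "drop 0 xs = xs" "drop (numeral n) (x # xs) = drop (pred_numeral n) xs"
  by (simp_all add: numeral_eq_Suc)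

lemmas sha_bits = bits_plus_32 Sigma0_bits_32 Sigma1_bits_32 sigma0_bits_32 sigma1_bits_32
  Ch_bits_32 Maj_bits_32 bitwise_simps add_bits.simps xor3_simps mux_def majority_def

lemmas sha_eval = sha_bits simp_thms if_True if_False sha_round_8 sha_schedule_16
  sliding_schedule_16 sliding_schedule.simps(1) Let_def fold_simps zip_Cons_Cons zip_Nil
  list.map prod.case sha_K_bits sha_init_bits sha_compress_fold pred_numeral_simps BitM.simps
  numeral_bits_32 zero_bits pad_num.simps

lemma sha_state:
  "fold sha_compress (sha_blocks (ascii_bytes (normalized_edge_list graph_H))) sha_init =
    [0x0f2d8858, 0x110c6f01, 0x2de7ddff, 0xa92fdbc7, 0x09d7da63, 0x0f199b0e, 0x3c81bb56, 0xeb6b35c7]"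
  unfolding sha_blocks_def sha_pad_message [OF length_message]
  \<comment> \<open>\<open>numeral_bits_32\<close> also turns the words of the claimed digest into
    bit lists, so both sides reach the same normal form.\<close>
  by (simp only: message_eval replicate_48 chunks_rules take_drop_rules pred_numeral_simps
    word_rcat_chars sha_eval)

lemma sha256_H:
  "hex_string (sha256 (ascii_bytes (normalized_edge_list graph_H))) =
    ''0f2d8858110c6f012de7ddffa92fdbc709d7da630f199b0e3c81bb56eb6b35c7''"
  unfolding sha256_def sha_state
  by (simp add: hex_string_def big_endian_bytes_def upt_rec unsigned_ucast_eq)

theorem theorem6p1:
  shows "simple_graph graph_H \<and> distinct H_edge_list
    \<and> connected_graph graph_H \<and> bridgeless graph_H \<and> cubic graph_H
    \<and> card (verts graph_H) = 112 \<and> card (edges graph_H) = 168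
    \<and> girth graph_H = 5
    \<and> edge_connectivity graph_H = 3 \<and> vertex_connectivity graph_H = 3
    \<and> (\<nexists>\<phi>. is_petersen_coloring graph_H \<phi>)
    \<and> (\<nexists>c. normal_5_edge_coloring graph_H c)
    \<and> automorphism_group graph_H \<cong> dihedral_group 3
    \<and> order (automorphism_group graph_H) = 6
    \<and> \<not> isomorphic_graphs graph_H graph_G
    \<and> hex_string (sha256 (ascii_bytes (normalized_edge_list graph_H))) =
        ''0f2d8858110c6f012de7ddffa92fdbc709d7da630f199b0e3c81bb56eb6b35c7''"
proof (intro conjI)
  show "card (verts graph_H) = 112" by (simp add: verts_H)
  show "\<nexists>\<phi>. is_petersen_coloring graph_H \<phi>"
    using petersen_coloring_normal no_normal_coloring_H simple_graph_H
    by (metis simple_graph_def)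
  show "\<nexists>c. normal_5_edge_coloring graph_H c"
    using no_normal_coloring_H by blast
qed (rule simple_graph_H distinct_H_edge_list connected_H bridgeless_H cubic_H card_edges_H girth_H
  edge_connectivity_H vertex_connectivity_H automorphism_group_H order_automorphism_group_H
  not_isomorphic_H_G sha256_H)+

end
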